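(* Let $d\ge1$, $K\ge0$, and $V:\mathbb R^d\to\mathbb R$ a potential. Let $(w_1,w_2,w_{12})$, functions of $(t,x,p)\in[0,\infty)\times\mathbb R^d\times\mathbb R^d$, be a solution of the two-oscillator Wigner–Lohe system $$ \begin{cases}\partial_t w_1+p\cdot\nabla_x w_1+\Theta[V]w_1=\frac K2\,(w_{12}^+-r_{12}w_1),\\ \partial_t w_2+p\cdot\nabla_x w_2+\Theta[V]w_2=\frac K2\,(w_{12}^+-r_{12}w_2),\\ \partial_t w_{12}+p\cdot\nabla_x w_{12}+\Theta[V]w_{12}=\frac K4\,(w_1+w_2-2z_{12}w_{12}),\end{cases} $$ where $w_{12}^+=\operatorname{Re}w_{12}$, $z_{12}(t)=\int w_{12}(t,x,p)\,dx\,dp$ and $r_{12}=\operatorname{Re}z_{12}$, with initial data $(w_1(0),w_2(0),w_{12}(0))=(w_1^0,w_2^0,w_{12}^0)$, where $w_1^0,w_2^0$ are real valued and $w_{12}^0$ is complex valued, such that $$ \int w_1^0(x,p)\,dx\,dp=\int w_2^0(x,p)\,dx\,dp=1, $$ $$ \Big|\int w_{12}^0(x,p)\,dx\,dp\Big|\le1,\qquad \int w_{12}^0(x,p)\,dx\,dp\ne-1. $$ Then $$ \|w_1(t)-w_2(t)\|_{L^2}^2\lesssim e^{-Kt}\quad\text{as }t\to\infty, $$ i.e. there is a constant $C>0$ independent of $t$ (depending on the initial data) such that $\|w_1(t)-w_2(t)\|_{L^2(\mathbb R^d\times\mathbb R^d)}^2\le Ce^{-Kt}$ for all sufficiently lar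ge $t$.
   Context: The operator $\Theta[V]$ is $$ \Theta[V](w)(x,p)=-\frac{i}{(2\pi)^d}\int e^{i(p-p')\cdot y}\Big(V\big(x+\tfrac y2\big)-V\big(x-\tfrac y2\big)\Big)w(x,p')\,dp'\,dy. $$ All integrals $\int\cdot\,dx\,dp$ and the $L^2$ norm are over the phase space $\mathbb R^d\times\mathbb R^d$. The system is considered independently of any underlying Schrödinger system. Solutions are understood to be sufficiently regular and decaying in $(x,p)$ that the quantities $\int w_j\,dx\,dp$, $\int w_{12}\,dx\,dp$ and $\|w_1-w_2\|_{L^2}$ are finite and the equations may be integrated over phase space, and the second-to-last type of integration (multiplying the equation for $w_1-w_2$ by $w_1-w_2$ and integrating) is legitimate. *)

theory Defs
  imports "HOL-Analysis.Analysis"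
begin

type_synonym 'd phase = "(real ^ 'd) \<times> (real ^ 'd)"

text \<open>The integrand of \<open>\<Theta>[V](w)(x,p)\<close>, without the prefactor.\<close>

definition Theta_integrand ::
    "(real ^ 'd \<Rightarrow> real) \<Rightarrow> ('d phase \<Rightarrow> complex)
      \<Rightarrow> real ^ 'd \<Rightarrow> real ^ 'd \<Rightarrow> real ^ 'd \<Rightarrow> real ^ 'd \<Rightarrow> complex" where
  "Theta_integrand V w x p y p' =
     exp (\<i> * complex_of_real ((p - p') \<bullet> y)) *
     complex_of_real (V (x + y /\<^sub>R 2) - V (x - y /\<^sub>R 2)) * w (x, p')"

text \<open>The \<open>dp' dy\<close> integral is an iterated one, with the \<open>p'\<close>-integral (a Fourier transform
  of \<open>w(x,\<cdot>)\<close>) inside: the modulus of the integrand does not decay in \<open>y\<close> on account of \<open>w\<close>, so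
  it is in general not absolutely integrable in \<open>(p',y)\<close> jointly. The Bochner integral of a
  non-integrable function is \<open>0\<close>, so convergence is recorded separately.\<close>

definition Theta ::
    "(real ^ 'd \<Rightarrow> real) \<Rightarrow> ('d::finite phase \<Rightarrow> complex) \<Rightarrow> 'd phase \<Rightarrow> complex" where
  "Theta V w = (\<lambda>(x, p).
     - (\<i> / complex_of_real ((2 * pi) ^ CARD('d))) *
       (LINT y|lborel. (LINT p'|lborel. Theta_integrand V w x p y p')))"

definition Theta_converges ::
    "(real ^ 'd \<Rightarrow> real) \<Rightarrow> ('d::finite phase \<Rightarrow> complex) \<Rightarrow> bool" where
  "Theta_converges V w \<longleftrightarrow>
     (\<forall>x p y. integrable lborel (Theta_integrand V w x p y)) \<and>
     (\<forall>x p. integrable lborel (\<lambda>y. LINT p'|lborel. Theta_integrand V w x p y p'))"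

text \<open>\<open>p \<cdot> \<nabla>\<^sub>x w\<close>, as the derivative in \<open>x\<close> applied to the direction \<open>p\<close>.\<close>

definition transport :: "('d::finite phase \<Rightarrow> complex) \<Rightarrow> 'd phase \<Rightarrow> complex" where
  "transport w = (\<lambda>(x, p). frechet_derivative (\<lambda>x'. w (x', p)) (at x) p)"

text \<open>Time runs over \<open>[0,\<infinity>)\<close>; the derivative at \<open>0\<close> is one-sided.\<close>

definition time_deriv :: "(real \<Rightarrow> 'z \<Rightarrow> complex) \<Rightarrow> real \<Rightarrow> 'z \<Rightarrow> complex" where
  "time_deriv w t z = vector_derivative (\<lambda>s. w s z) (at t within {0..})"

definition phase_integral :: "('d::finite phase \<Rightarrow> complex) \<Rightarrow> complex" where
  "phase_integral f = (LINT z|lborel. f z)"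

definition L2_norm_phase :: "('d::finite phase \<Rightarrow> complex) \<Rightarrow> real" where
  "L2_norm_phase f = sqrt (LINT z|lborel. (cmod (f z))\<^sup>2)"

definition slab_integrable :: "(real \<Rightarrow> 'd::finite phase \<Rightarrow> complex) \<Rightarrow> bool" where
  "slab_integrable f \<longleftrightarrow>
     (\<forall>T\<ge>0. set_integrable lborel ({0..T} \<times> UNIV) (\<lambda>(t, z). f t z))"

text \<open>Regularity and decay under which the three terms on the left of each equation are defined
  pointwise and the equation can be integrated over \<open>[0,T]\<close> times phase space. Only
  integrability is required; that the transport and potential terms integrate to zero is not
  part of the assumption.\<close>

definition admissible ::
    "(real ^ 'd \<Rightarrow> real) \<Rightarrow> (real \<Rightarrow> 'd::finite phase \<Rightarrow> complex) \<Rightarrow> bool" where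
  "admissible V w \<longleftrightarrow>
     (\<forall>t\<ge>0. \<forall>z. (\<lambda>s. w s z) differentiable (at t within {0..})) \<and>
     (\<forall>t\<ge>0. \<forall>x p. (\<lambda>x'. w t (x', p)) differentiable (at x)) \<and>
     (\<forall>t\<ge>0. Theta_converges V (w t)) \<and>
     (\<forall>t\<ge>0. integrable lborel (w t)) \<and>
     slab_integrable (time_deriv w) \<and>
     slab_integrable (\<lambda>t. transport (w t)) \<and>
     slab_integrable (\<lambda>t. Theta V (w t))"

text \<open>The corresponding condition for multiplying an equation for \<open>u\<close> by \<open>u\<close> and integrating
  (for complex-valued \<open>u\<close> the multiplier is the conjugate).\<close>

definition energy_admissible ::
    "(real ^ 'd \<Rightarrow> real) \<Rightarrow> (real \<Rightarrow> 'd::finite phase \<Rightarrow> complex) \<Rightarrow> bool" where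
  "energy_admissible V u \<longleftrightarrow>
     (\<forall>t\<ge>0. integrable lborel (\<lambda>z. (cmod (u t z))\<^sup>2)) \<and>
     slab_integrable (\<lambda>t z. cnj (u t z) * time_deriv u t z) \<and>
     slab_integrable (\<lambda>t z. cnj (u t z) * transport (u t) z) \<and>
     slab_integrable (\<lambda>t z. cnj (u t z) * Theta V (u t) z)"

text \<open>All three unknowns are complex-valued here; for \<open>w\<^sub>1\<close> and \<open>w\<^sub>2\<close> only the initial data are
  required to be real, so solutions with real-valued \<open>w\<^sub>1(t)\<close>, \<open>w\<^sub>2(t)\<close> are included.\<close>

definition wigner_lohe_solution ::
    "real \<Rightarrow> (real ^ 'd \<Rightarrow> real)
      \<Rightarrow> (real \<Rightarrow> 'd::finite phase \<Rightarrow> complex) \<Rightarrow> (real \<Rightarrow> 'd phase \<Rightarrow> complex)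
      \<Rightarrow> (real \<Rightarrow> 'd phase \<Rightarrow> complex) \<Rightarrow> bool" where
  "wigner_lohe_solution K V w1 w2 w12 \<longleftrightarrow>
     admissible V w1 \<and> admissible V w2 \<and> admissible V w12 \<and>
     energy_admissible V (\<lambda>t z. w1 t z - w2 t z) \<and>
     (\<forall>t\<ge>0. \<forall>z.
        let z12 = phase_integral (w12 t); r12 = Re z12 in
          time_deriv w1 t z + transport (w1 t) z + Theta V (w1 t) z
            = (K / 2) *\<^sub>R (complex_of_real (Re (w12 t z)) - r12 *\<^sub>R w1 t z) \<and>
          time_deriv w2 t z + transport (w2 t) z + Theta V (w2 t) z
            = (K / 2) *\<^sub>R (complex_of_real (Re (w12 t z)) - r12 *\<^sub>R w2 t z) \<and>
          time_deriv w12 t z + transport (w12 t) z + Theta V (w12 t) z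
            = (K / 4) *\<^sub>R (w1 t z + w2 t z - 2 * z12 * w12 t z))"

end

theory Submission
  imports Defs "HOL-Probability.Characteristic_Functions"
begin

text \<open>
  Integrating the equations over phase space turns the system into ordinary differential
  equations, provided that transport and potential contribute nothing. Granted this, the masses
  of \<open>w\<^sub>1\<close> and \<open>w\<^sub>2\<close> stay equal to \<open>1\<close> (the defect \<open>m - 1\<close> solves a homogeneous linear equation),
  hence \<open>z = \<integral> w\<^sub>1\<^sub>2\<close> solves the Riccati equation \<open>z' = K/2 (1 - z\<^sup>2)\<close>, and pairing the equation for
  \<open>w\<^sub>1 - w\<^sub>2\<close> with its conjugate gives \<open>N' = - K (Re z) N\<close> for the squared norm \<open>N\<close>. The Riccati
  equation linearises as \<open>z = E / D\<close> with
  \<open>D = e\<^sup>s (1 + z\<^sub>0) + e\<^sup>-\<^sup>s (1 - z\<^sub>0)\<close> and \<open>E = e\<^sup>s (1 + z\<^sub>0) - e\<^sup>-\<^sup>s (1 - z\<^sub>0)\<close>, where \<open>s = K t / 2\<close>.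
  Since \<open>(|D|\<^sup>2)' = K (Re z) |D|\<^sup>2\<close>, the product \<open>N |D|\<^sup>2\<close> is conserved. If \<open>|z\<^sub>0| \<le> 1\<close>, the cross term in
  \<open>|D|\<^sup>2\<close> is nonnegative, so \<open>|D|\<^sup>2 \<ge> e\<^sup>K\<^sup>t |1 + z\<^sub>0|\<^sup>2\<close>, and \<open>N\<close> decays like \<open>e\<^sup>-\<^sup>K\<^sup>t\<close> as soon as \<open>z\<^sub>0 \<noteq> -1\<close>
  (lemma \<open>decay_of_order_parameter_system\<close>).

  The work lies in the vanishing of the transport and potential contributions, for which only
  integrability is available. For transport, both statements (for the mass and for the energy) follow from
  translation invariance of Lebesgue measure (\<open>integral_directional_derivative\<close>). For the
  potential, fix \<open>x\<close>: up to a constant, \<open>\<Theta>[V]w(x,\<cdot>)\<close> is the Fourier transform of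
  \<open>F(y) = (V(x+y/2) - V(x-y/2)) W(x,y)\<close>, with \<open>W\<close> the Fourier transform of \<open>w\<close> in momentum. The energy
  term is, by Fubini, an imaginary multiple of the integral of the real function
  \<open>(V(x+y/2) - V(x-y/2)) |W(x,y)|\<^sup>2\<close> (\<open>energy_Theta\<close>). The mass term is formally \<open>F(0) = 0\<close>. As \<open>V\<close>
  is only measurable, this is made precise as follows (\<open>integral_Theta\<close>). By Fourier
  inversion \<open>F\<close> agrees almost everywhere with a continuous function \<open>G\<close>, and the mass term is a multiple of
  \<open>G(0)\<close>. For almost every \<open>x\<close> the difference \<open>V(x+y/2) - V(x-y/2)\<close> is arbitrarily small on a
  set of \<open>y\<close> of positive measure in every ball about \<open>0\<close> (\<open>AE_symmetric_difference_small\<close>). So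
  there are points \<open>y \<rightarrow> 0\<close> with \<open>G(y) = F(y) \<rightarrow> 0\<close>, whence \<open>G(0) = 0\<close>.
\<close>

section \<open>Fourier inversion for integrable functions with integrable transform\<close>

definition gaussian :: "'a::euclidean_space \<Rightarrow> real" where
  "gaussian p = exp (- (norm p)\<^sup>2 / 2)"

lemma gaussian_measurable [measurable]: "gaussian \<in> borel_measurable borel"
  unfolding gaussian_def by measurable

lemma gaussian_bounds: "0 < gaussian p" "gaussian p \<le> 1"
  by (auto simp: gaussian_def)

lemma gaussian_nonneg [simp]: "0 \<le> gaussian p"
  by (simp add: gaussian_def)

lemma abs_gaussian [simp]: "\<bar>gaussian p\<bar> = gaussian p"
  by (simp add: gaussian_def)

lemma char_std_normal_lborel:
  "integrable lborel (\<lambda>x. exp (\<i> * complex_of_real (x * t)) * complex_of_real (exp (- x\<^sup>2 / 2)))"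
  "(LINT x|lborel. exp (\<i> * complex_of_real (x * t)) * complex_of_real (exp (- x\<^sup>2 / 2)))
     = complex_of_real (sqrt (2 * pi) * exp (- t\<^sup>2 / 2))"
proof -
  have "integrable lborel std_normal_density" by simp
  then have i: "integrable lborel (\<lambda>x. sqrt (2 * pi) * std_normal_density x)"
    by (intro integrable_mult_right) auto
  have e: "(\<lambda>x. sqrt (2 * pi) * std_normal_density x) = (\<lambda>x. exp (- x\<^sup>2 / 2))"
    by (auto simp: std_normal_density_def)
  have "integrable lborel (\<lambda>x. exp (- x\<^sup>2 / 2) :: real)" using i unfolding e .
  then show "integrable lborel (\<lambda>x. exp (\<i> * complex_of_real (x * t)) * complex_of_real (exp (- x\<^sup>2 / 2)))"
    by (rule Bochner_Integration.integrable_bound) (auto simp: norm_mult norm_exp_i_times)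
  have "complex_of_real (exp (- (t^2) / 2)) = char std_normal_distribution t"
    by (simp add: char_std_normal_distribution)
  also have "\<dots> = (LINT x|lborel. std_normal_density x *\<^sub>R iexp (t * x))"
    unfolding char_def by (subst integral_density) auto
  also have "\<dots> = (LINT x|lborel. (1 / complex_of_real (sqrt (2 * pi))) *
      (exp (\<i> * complex_of_real (x * t)) * complex_of_real (exp (- x\<^sup>2 / 2))))"
    by (rule Bochner_Integration.integral_cong) (auto simp: std_normal_density_def scaleR_conv_of_real field_simps)
  also have "\<dots> = (1 / complex_of_real (sqrt (2 * pi))) * (LINT x|lborel. 
      (exp (\<i> * complex_of_real (x * t)) * complex_of_real (exp (- x\<^sup>2 / 2))))"
    by (rule integral_mult_right_zero)
  finally show "(LINT x|lborel. exp (\<i> * complex_of_real (x * t)) * complex_of_real (exp (- x\<^sup>2 / 2)))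
     = complex_of_real (sqrt (2 * pi) * exp (- t\<^sup>2 / 2))"
    by (simp add: field_simps)
qed

text \<open>
  The integrand is a product of functions of the coordinates, so this reduces to the
  characteristic function of the standard normal distribution in each coordinate.
\<close>

lemma gaussian_fourier:
  fixes y :: "'a::euclidean_space"
  shows "integrable lborel (\<lambda>p::'a. exp (\<i> * complex_of_real (p \<bullet> y)) * complex_of_real (gaussian p))"
    and "(LINT p|lborel. exp (\<i> * complex_of_real (p \<bullet> y)) * complex_of_real (gaussian p))
      = complex_of_real (sqrt (2 * pi) ^ DIM('a) * gaussian y)"
proof -
  interpret product_sigma_finite "\<lambda>_::'a. lborel :: real measure" ..
  define f where "f = (\<lambda>(b::'a) x. exp (\<i> * complex_of_real (x * (y \<bullet> b))) * complex_of_real (exp (- x\<^sup>2 / 2)))"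
  have nrm: "(norm (p::'a))\<^sup>2 = (\<Sum>b\<in>Basis. (p \<bullet> b)\<^sup>2)" for p
    by (subst power2_norm_eq_inner, subst euclidean_inner) (simp add: power2_eq_square)
  have g: "gaussian p = (\<Prod>b\<in>Basis. exp (- (p \<bullet> b)\<^sup>2 / 2))" for p :: 'a
    unfolding gaussian_def nrm by (simp add: sum_negf sum_divide_distrib exp_sum[symmetric])
  have eq: "exp (\<i> * complex_of_real (p \<bullet> y)) * complex_of_real (gaussian p) = (\<Prod>b\<in>Basis. f b (p \<bullet> b))" for p
    unfolding f_def g prod.distrib of_real_prod
    by (subst euclidean_inner) (simp add: sum_distrib_left exp_sum mult.commute)
  have m: "(\<lambda>x. exp (\<i> * complex_of_real (x \<bullet> y)) * complex_of_real (gaussian x)) \<in> borel_measurable borel"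
    by measurable
  have l: "(\<Sum>b\<in>Basis. \<omega> b *\<^sub>R b) \<bullet> b = \<omega> b" if "b \<in> Basis" for \<omega> and b :: 'a
    using that by simp
  have i: "integrable lborel (f b)" for b unfolding f_def by (rule char_std_normal_lborel)
  have mm: "(\<lambda>f. \<Sum>b\<in>Basis. f b *\<^sub>R (b::'a)) \<in> (\<Pi>\<^sub>M b\<in>Basis. lborel) \<rightarrow>\<^sub>M borel"
    by measurable
  show "integrable lborel (\<lambda>p::'a. exp (\<i> * complex_of_real (p \<bullet> y)) * complex_of_real (gaussian p))"
    apply (subst lborel_eq)
    apply (subst integrable_distr_eq[OF mm m])
    unfolding eq using i by (simp add: product_integrable_prod cong: prod.cong)
  have "(LINT p|lborel. exp (\<i> * complex_of_real (p \<bullet> y)) * complex_of_real (gaussian p))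
     = (LINT \<omega>|(\<Pi>\<^sub>M b\<in>(Basis::'a set). lborel). (\<Prod>b\<in>Basis. f b (\<omega> b)))"
    apply (subst lborel_eq)
    apply (subst integral_distr[OF mm m])
    unfolding eq by (simp cong: prod.cong)
  also have "\<dots> = (\<Prod>b\<in>Basis. LINT x|lborel. f b x)"
    using i by (intro product_integral_prod) auto
  also have "\<dots> = (\<Prod>b\<in>(Basis::'a set). complex_of_real (sqrt (2 * pi) * exp (- (y \<bullet> b)\<^sup>2 / 2)))"
    unfolding f_def by (simp only: char_std_normal_lborel)
  also have "\<dots> = complex_of_real (sqrt (2 * pi) ^ DIM('a) * gaussian y)"
    unfolding g by (simp add: prod.distrib)
  finally show "(LINT p|lborel. exp (\<i> * complex_of_real (p \<bullet> y)) * complex_of_real (gaussian p))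
      = complex_of_real (sqrt (2 * pi) ^ DIM('a) * gaussian y)" .
qed

lemma gaussian_integral:
  "integrable lborel (gaussian :: 'a::euclidean_space \<Rightarrow> real)"
  "(LINT p|lborel. gaussian (p::'a)) = sqrt (2 * pi) ^ DIM('a)"
proof -
  have i: "integrable lborel (\<lambda>p::'a. complex_of_real (gaussian p))"
    using gaussian_fourier(1)[of 0] by simp
  then show "integrable lborel (gaussian :: 'a::euclidean_space \<Rightarrow> real)"
    using integrable_Re[OF i] by simp
  have "(LINT p|lborel. complex_of_real (gaussian (p::'a))) = complex_of_real (sqrt (2 * pi) ^ DIM('a))"
    using gaussian_fourier(2)[of "0::'a"] by (simp add: gaussian_def)
  then show "(LINT p|lborel. gaussian (p::'a)) = sqrt (2 * pi) ^ DIM('a)"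
    by (metis integral_complex_of_real of_real_eq_iff)
qed

lemma integral_affine:
  fixes f :: "'a::euclidean_space \<Rightarrow> 'b::{banach,second_countable_topology}"
  assumes c: "c \<noteq> 0" and [measurable]: "f \<in> borel_measurable borel"
  shows "integral\<^sup>L lborel f = \<bar>c\<bar> ^ DIM('a) *\<^sub>R (LINT x|lborel. f (t + c *\<^sub>R x))"
    and "integrable lborel f \<longleftrightarrow> integrable lborel (\<lambda>x. f (t + c *\<^sub>R x))"
proof -
  have "integral\<^sup>L lborel f = integral\<^sup>L (density (distr lborel borel (\<lambda>x. t + c *\<^sub>R x)) (\<lambda>_. ennreal (\<bar>c\<bar> ^ DIM('a)))) f"
    using lborel_affine[OF c, of t] by simp
  also have "\<dots> = (LINT x|distr lborel borel (\<lambda>x. t + c *\<^sub>R x). \<bar>c\<bar> ^ DIM('a) *\<^sub>R f x)"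
    by (rule integral_density) auto
  also have "\<dots> = \<bar>c\<bar> ^ DIM('a) *\<^sub>R (LINT x|lborel. f (t + c *\<^sub>R x))"
    by (subst integral_distr) auto
  finally show "integral\<^sup>L lborel f = \<bar>c\<bar> ^ DIM('a) *\<^sub>R (LINT x|lborel. f (t + c *\<^sub>R x))" .
  have "integrable lborel f \<longleftrightarrow> integrable (density (distr lborel borel (\<lambda>x. t + c *\<^sub>R x)) (\<lambda>_. ennreal (\<bar>c\<bar> ^ DIM('a)))) f"
    using lborel_affine[OF c, of t] by simp
  also have "\<dots> \<longleftrightarrow> integrable (distr lborel borel (\<lambda>x. t + c *\<^sub>R x)) (\<lambda>x. \<bar>c\<bar> ^ DIM('a) *\<^sub>R f x)"
    by (rule integrable_density) auto
  also have "\<dots> \<longleftrightarrow> integrable lborel (\<lambda>x. \<bar>c\<bar> ^ DIM('a) *\<^sub>R f (t + c *\<^sub>R x))"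
    by (subst integrable_distr_eq) auto
  also have "\<dots> \<longleftrightarrow> integrable lborel (\<lambda>x. f (t + c *\<^sub>R x))"
  proof
    assume "integrable lborel (\<lambda>x. \<bar>c\<bar> ^ DIM('a) *\<^sub>R f (t + c *\<^sub>R x))"
    from integrable_scaleR_right[OF this, of "1 / \<bar>c\<bar> ^ DIM('a)"]
    show "integrable lborel (\<lambda>x. f (t + c *\<^sub>R x))" using c by simp
  qed simp
  finally show "integrable lborel f \<longleftrightarrow> integrable lborel (\<lambda>x. f (t + c *\<^sub>R x))" .
qed

text \<open>
  Fubini: the double integral converges absolutely because both functions are integrable.
\<close>

lemma fourier_multiplication_formula:
  fixes f F :: "'a::euclidean_space \<Rightarrow> complex"
  assumes f: "integrable lborel f" and F: "integrable lborel F"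
  shows "(LINT p|lborel. f p * (LINT y|lborel. exp (\<i> * complex_of_real (p \<bullet> y)) * F y))
    = (LINT y|lborel. F y * (LINT p|lborel. exp (\<i> * complex_of_real (p \<bullet> y)) * f p))"
proof -
  have [measurable]: "f \<in> borel_measurable borel" "F \<in> borel_measurable borel"
    using f F by auto
  have "integrable (lborel \<Otimes>\<^sub>M lborel) (\<lambda>(p, y). f p * (exp (\<i> * complex_of_real (p \<bullet> y)) * F y))"
  proof (rule lborel_pair.Fubini_integrable)
    show "integrable lborel (\<lambda>x. LINT y|lborel. norm (case (x, y) of (p, y) \<Rightarrow> f p * (exp (\<i> * complex_of_real (p \<bullet> y)) * F y)))"
      using f by (simp add: norm_mult)
    show "AE x in lborel. integrable lborel (\<lambda>y. case (x, y) of (p, y) \<Rightarrow> f p * (exp (\<i> * complex_of_real (p \<bullet> y)) * F y))"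
    proof (rule AE_I2)
      fix x
      have "integrable lborel (\<lambda>y. exp (\<i> * complex_of_real (x \<bullet> y)) * F y)"
        by (rule Bochner_Integration.integrable_bound[OF F]) (auto simp: norm_mult)
      then show "integrable lborel (\<lambda>y. case (x, y) of (p, y) \<Rightarrow> f p * (exp (\<i> * complex_of_real (p \<bullet> y)) * F y))"
        by simp
    qed
  qed measurable
  from lborel_pair.Fubini_integral[OF this, symmetric]
  have "(LINT p|lborel. LINT y|lborel. f p * (exp (\<i> * complex_of_real (p \<bullet> y)) * F y))
    = (LINT y|lborel. LINT p|lborel. f p * (exp (\<i> * complex_of_real (p \<bullet> y)) * F y))"
    by simp
  also have "\<dots> = (LINT y|lborel. LINT p|lborel. F y * (exp (\<i> * complex_of_real (p \<bullet> y)) * f p))"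
    by (simp add: mult_ac)
  finally show ?thesis by simp
qed

text \<open>
  The measures with densities \<open>h\<^sup>+\<close> and \<open>h\<^sup>-\<close> agree on boxes, which form an intersection-stable
  generator of the Borel sets, and are finite there. So they are equal, and so are the densities.
\<close>

lemma AE_zero_if_box_integrals_zero_real:
  fixes h :: "'a::euclidean_space \<Rightarrow> real"
  assumes i: "\<And>a b. set_integrable lborel (box a b) h" and z: "\<And>a b. (LINT x:box a b|lborel. h x) = 0"
    and [measurable]: "h \<in> borel_measurable borel"
  shows "AE x in lborel. h x = 0"
proof -
  let ?M = "density lborel (\<lambda>x. ennreal (h x))" and ?N = "density lborel (\<lambda>x. ennreal (- h x))"
  have fin: "emeasure ?M (box a b) = emeasure ?N (box a b) \<and> emeasure ?M (box a b) < \<infinity>" for a b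
  proof -
    let ?g = "\<lambda>x. indicator (box a b) x *\<^sub>R h x"
    have g: "integrable lborel ?g" using i[of a b] unfolding set_integrable_def .
    have eq: "ennreal (h x) * indicator (box a b) x = ennreal (?g x)"
      "ennreal (- h x) * indicator (box a b) x = ennreal (- ?g x)" for x
      by (auto simp: indicator_def)
    have 1: "emeasure ?M (box a b) = (\<integral>\<^sup>+x. ennreal (?g x) \<partial>lborel)"
      "emeasure ?N (box a b) = (\<integral>\<^sup>+x. ennreal (- ?g x) \<partial>lborel)"
      by (simp_all only: eq[symmetric], auto simp: emeasure_density)
    have f: "(\<integral>\<^sup>+x. ennreal (?g x) \<partial>lborel) \<noteq> \<infinity>" "(\<integral>\<^sup>+x. ennreal (- ?g x) \<partial>lborel) \<noteq> \<infinity>"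
      using g unfolding real_integrable_def by auto
    have "0 = integral\<^sup>L lborel ?g" using z[of a b] unfolding set_lebesgue_integral_def by simp
    also have "\<dots> = enn2real (\<integral>\<^sup>+x. ennreal (?g x) \<partial>lborel) - enn2real (\<integral>\<^sup>+x. ennreal (- ?g x) \<partial>lborel)"
      by (rule real_lebesgue_integral_def[OF g])
    finally show ?thesis using f unfolding 1
      by (metis diff_add_cancel add_0 ennreal_enn2real top.not_eq_extremum infinity_ennreal_def)
  qed
  have "?M = ?N"
  proof (rule measure_eqI_generator_eq)
    let ?E = "range (\<lambda>(a, b). box a b :: 'a set)"
    show "Int_stable ?E" by (auto simp: Int_stable_def box_Int_box)
    show "?E \<subseteq> Pow UNIV" by auto
    show "emeasure ?M X = emeasure ?N X" if "X \<in> ?E" for X using that fin by auto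
    show "sets ?M = sigma_sets UNIV ?E" "sets ?N = sigma_sets UNIV ?E"
      by (simp_all add: borel_eq_box)
    show "range (\<lambda>n::nat. box (- (real n *\<^sub>R One)) (real n *\<^sub>R One) :: 'a set) \<subseteq> ?E" by auto
    show "(\<Union>n. box (- (real n *\<^sub>R One)) (real n *\<^sub>R One) :: 'a set) = UNIV"
      by (rule UN_box_eq_UNIV)
    show "emeasure ?M (box (- (real n *\<^sub>R One)) (real n *\<^sub>R One)) \<noteq> \<infinity>" for n
      using fin[of "- (real n *\<^sub>R One)" "real n *\<^sub>R One"] by auto
  qed
  then have "AE x in lborel. ennreal (h x) = ennreal (- h x)"
    by (intro sigma_finite_measure.density_unique[OF sigma_finite_lborel]) auto
  then show ?thesis
  proof eventually_elim
    case (elim x) then show ?case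
      by (cases "h x" "0::real" rule: linorder_cases) (auto simp: ennreal_neg)
  qed
qed

lemma AE_zero_if_box_integrals_zero:
  fixes h :: "'a::euclidean_space \<Rightarrow> complex"
  assumes i: "\<And>a b. set_integrable lborel (box a b) h" and z: "\<And>a b. (LINT x:box a b|lborel. h x) = 0"
    and [measurable]: "h \<in> borel_measurable borel"
  shows "AE x in lborel. h x = 0"
proof -
  have i': "integrable lborel (\<lambda>x. indicator (box a b) x *\<^sub>R h x)" for a b
    using i[of a b] unfolding set_integrable_def .
  have z': "(LINT x|lborel. indicator (box a b) x *\<^sub>R h x) = 0" for a b
    using z[of a b] unfolding set_lebesgue_integral_def .
  have "AE x in lborel. Re (h x) = 0"
    using integral_Re[OF i'] integrable_Re[OF i'] z'
    by (intro AE_zero_if_box_integrals_zero_real) (auto simp: set_integrable_def set_lebesgue_integral_def)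
  moreover have "AE x in lborel. Im (h x) = 0"
    using integral_Im[OF i'] integrable_Im[OF i'] z'
    by (intro AE_zero_if_box_integrals_zero_real) (auto simp: set_integrable_def set_lebesgue_integral_def)
  ultimately show ?thesis by eventually_elim (simp add: complex_eq_iff)
qed

lemma fourier_continuous:
  fixes f :: "'a::euclidean_space \<Rightarrow> complex"
  assumes f: "integrable lborel f" and X: "X \<longlonglongrightarrow> y"
  shows "(\<lambda>n. LINT p|lborel. exp (\<i> * complex_of_real (- (p \<bullet> X n))) * f p)
     \<longlonglongrightarrow> (LINT p|lborel. exp (\<i> * complex_of_real (- (p \<bullet> y))) * f p)"
proof (rule integral_dominated_convergence[where w="\<lambda>p. norm (f p)"])
  have [measurable]: "f \<in> borel_measurable borel" using f by auto
  show "(\<lambda>p. exp (\<i> * complex_of_real (- (p \<bullet> y))) * f p) \<in> borel_measurable lborel"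
    "(\<lambda>p. exp (\<i> * complex_of_real (- (p \<bullet> X n))) * f p) \<in> borel_measurable lborel" for n by measurable
  show "AE p in lborel. (\<lambda>n. exp (\<i> * complex_of_real (- (p \<bullet> X n))) * f p) \<longlonglongrightarrow> exp (\<i> * complex_of_real (- (p \<bullet> y))) * f p"
    by (intro AE_I2 tendsto_intros X)
qed (use f in \<open>auto simp: norm_mult norm_exp_i_times\<close>)

text \<open>
  Damping the inverse transform by a Gaussian of width \<open>1/\<epsilon>\<close> makes all integrals absolutely
  convergent and produces an average of \<open>F\<close> at scale \<open>\<epsilon>\<close>. As \<open>\<epsilon> \<rightarrow> 0\<close> this yields the inversion
  formula.
\<close>

lemma gaussian_summability:
  fixes F :: "'a::euclidean_space \<Rightarrow> complex"
  assumes F: "integrable lborel F" and e: "\<epsilon> > 0"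
  shows "(LINT p|lborel. exp (\<i> * complex_of_real (- (p \<bullet> y\<^sub>0))) * complex_of_real (gaussian (\<epsilon> *\<^sub>R p)) *
            (LINT y|lborel. exp (\<i> * complex_of_real (p \<bullet> y)) * F y))
    = complex_of_real (sqrt (2 * pi) ^ DIM('a)) *
        (LINT z|lborel. F (y\<^sub>0 + \<epsilon> *\<^sub>R z) * complex_of_real (gaussian z))"
proof -
  let ?s = "complex_of_real (sqrt (2 * pi) ^ DIM('a))"
  define f where "f = (\<lambda>p::'a. exp (\<i> * complex_of_real (- (p \<bullet> y\<^sub>0))) * complex_of_real (gaussian (\<epsilon> *\<^sub>R p)))"
  have [measurable]: "F \<in> borel_measurable borel" using F by auto
  have "integrable lborel (\<lambda>p::'a. complex_of_real (gaussian p))"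
    by (intro integrable_of_real gaussian_integral(1))
  \<comment> \<open>integrability of the damping factor, by rescaling\<close>
  then have ig: "integrable lborel (\<lambda>p::'a. complex_of_real (gaussian (\<epsilon> *\<^sub>R p)))"
    using integral_affine(2)[of \<epsilon> "\<lambda>p. complex_of_real (gaussian p)" "0::'a"] e by simp
  have f: "integrable lborel f" unfolding f_def
    by (rule Bochner_Integration.integrable_bound[OF ig]) (auto simp: norm_mult norm_exp_i_times)
  have inner: "(LINT p|lborel. exp (\<i> * complex_of_real (p \<bullet> y)) * f p)
      = (1 / \<epsilon> ^ DIM('a)) *\<^sub>R (?s * complex_of_real (gaussian ((y - y\<^sub>0) /\<^sub>R \<epsilon>)))" for y
  proof -
    let ?v = "(y - y\<^sub>0) /\<^sub>R \<epsilon>"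
    have "exp (\<i> * complex_of_real ((\<epsilon> *\<^sub>R p) \<bullet> ?v)) * complex_of_real (gaussian (\<epsilon> *\<^sub>R p))
      = exp (\<i> * complex_of_real (p \<bullet> y)) * f p" for p
    proof -
      have "(\<epsilon> *\<^sub>R p) \<bullet> ?v = p \<bullet> y - p \<bullet> y\<^sub>0" using e by (simp add: inner_diff_right field_simps)
      then show ?thesis
        by (simp only: f_def of_real_diff of_real_minus right_diff_distrib exp_diff mult_minus_right exp_minus)
          (simp add: field_simps)
    qed
    note scaled = this
    have "?s * complex_of_real (gaussian ?v)
        = (LINT p|lborel. exp (\<i> * complex_of_real (p \<bullet> ?v)) * complex_of_real (gaussian p))"
      by (simp only: gaussian_fourier(2) of_real_mult)
    also have "\<dots> = \<bar>\<epsilon>\<bar> ^ DIM('a) *\<^sub>R (LINT p|lborel.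
        exp (\<i> * complex_of_real ((0 + \<epsilon> *\<^sub>R p) \<bullet> ?v)) * complex_of_real (gaussian (0 + \<epsilon> *\<^sub>R p)))"
      by (rule integral_affine(1)) (use e in auto)
    also have "\<dots> = \<epsilon> ^ DIM('a) *\<^sub>R (LINT p|lborel. exp (\<i> * complex_of_real (p \<bullet> y)) * f p)"
      unfolding add_0 scaled using e by simp
    finally have "?s * complex_of_real (gaussian ?v) = \<epsilon> ^ DIM('a) *\<^sub>R (LINT p|lborel. exp (\<i> * complex_of_real (p \<bullet> y)) * f p)" .
    then show ?thesis using e by simp
  qed
  have "(LINT p|lborel. f p * (LINT y|lborel. exp (\<i> * complex_of_real (p \<bullet> y)) * F y))
     = (LINT y|lborel. F y * (LINT p|lborel. exp (\<i> * complex_of_real (p \<bullet> y)) * f p))"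
    by (rule fourier_multiplication_formula[OF f F])
  also have "\<dots> = (LINT y|lborel. (1 / \<epsilon> ^ DIM('a)) *\<^sub>R (?s * (F y * complex_of_real (gaussian ((y - y\<^sub>0) /\<^sub>R \<epsilon>)))))"
    unfolding inner by (simp add: mult_ac)
  also have "\<dots> = (1 / \<epsilon> ^ DIM('a)) *\<^sub>R (?s * (LINT y|lborel. F y * complex_of_real (gaussian ((y - y\<^sub>0) /\<^sub>R \<epsilon>))))"
    by simp
  also have "(LINT y|lborel. F y * complex_of_real (gaussian ((y - y\<^sub>0) /\<^sub>R \<epsilon>)))
     = \<epsilon> ^ DIM('a) *\<^sub>R (LINT z|lborel. F (y\<^sub>0 + \<epsilon> *\<^sub>R z) * complex_of_real (gaussian z))"
    using integral_affine(1)[of \<epsilon> "\<lambda>y. F y * complex_of_real (gaussian ((y - y\<^sub>0) /\<^sub>R \<epsilon>))" y\<^sub>0] e by simp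
  finally show ?thesis using e unfolding f_def by simp
qed

text \<open>
  Only on the boundary of the box, a null set, can the indicator functions of the translates fail to
  converge.
\<close>

lemma box_integral_translate_tendsto:
  fixes F :: "'a::euclidean_space \<Rightarrow> complex"
  assumes F: "integrable lborel F" and e: "e \<longlonglongrightarrow> (0::real)"
  shows "(\<lambda>n. LINT y|lborel. indicator (box a b) (y - e n *\<^sub>R z) *\<^sub>R F y)
    \<longlonglongrightarrow> (LINT y|lborel. indicator (box a b) y *\<^sub>R F y)"
proof (rule integral_dominated_convergence[where w="\<lambda>p. norm (F p)"])
  have [measurable]: "F \<in> borel_measurable borel" using F by auto
  show "(\<lambda>y. indicator (box a b) y *\<^sub>R F y) \<in> borel_measurable lborel"
    "(\<lambda>y. indicator (box a b) (y - e n *\<^sub>R z) *\<^sub>R F y) \<in> borel_measurable lborel" for n by measurable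
  have c: "(\<lambda>n. y - e n *\<^sub>R z) \<longlonglongrightarrow> y" for y
    using tendsto_diff[OF tendsto_const tendsto_scaleR[OF e tendsto_const]] by simp
  have "AE y in lborel. y \<notin> cbox a b - box a b"
    using negligible_frontier_interval[of a b] 
    by (intro AE_not_in) (auto simp: negligible_iff_null_sets null_sets_completion_iff)
  then show "AE y in lborel. (\<lambda>n. indicator (box a b) (y - e n *\<^sub>R z) *\<^sub>R F y) \<longlonglongrightarrow> indicator (box a b) y *\<^sub>R F y"
  proof eventually_elim
    case (elim y)
    have "\<forall>\<^sub>F n in sequentially. indicator (box a b) (y - e n *\<^sub>R z) = (indicator (box a b) y :: real)"
    proof (cases "y \<in> box a b")
      case True
      have "\<forall>\<^sub>F n in sequentially. y - e n *\<^sub>R z \<in> box a b"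
        by (rule topological_tendstoD[OF c]) (use True in auto)
      then show ?thesis by eventually_elim (use True in auto)
    next
      case False
      have "\<forall>\<^sub>F n in sequentially. y - e n *\<^sub>R z \<in> - cbox a b"
        by (rule topological_tendstoD[OF c]) (use False elim in \<open>auto simp: closed_cbox open_Compl\<close>)
      then show ?thesis by eventually_elim (use False box_subset_cbox in \<open>auto simp: indicator_def\<close>)
    qed
    then show ?case by (intro tendsto_scaleR tendsto_const tendsto_eventually)
  qed
  show "AE y in lborel. norm (indicator (box a b) (y - e n *\<^sub>R z) *\<^sub>R F y) \<le> norm (F y)" for n
    by (auto simp: indicator_def)
qed (use F in auto)

text \<open>
  Both sides of the formula have the same integrals over boxes. Integrate the identity for Gaussian
  averages over a box and let the scale tend to \<open>0\<close>: on the side of \<open>\<Phi>\<close> dominated convergence applies,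
  and on the side of \<open>F\<close> too once the translation has been moved from \<open>F\<close> onto the indicator of the
  box.
\<close>

theorem fourier_inversion_AE:
  fixes F :: "'a::euclidean_space \<Rightarrow> complex"
  defines "\<Phi> \<equiv> \<lambda>p. LINT y|lborel. exp (\<i> * complex_of_real (p \<bullet> y)) * F y"
  assumes F: "integrable lborel F" and P: "integrable lborel \<Phi>"
  shows "AE y in lborel. (2 * pi) ^ DIM('a) *\<^sub>R F y
     = (LINT p|lborel. exp (\<i> * complex_of_real (- (p \<bullet> y))) * \<Phi> p)"
proof -
  let ?s = "sqrt (2 * pi) ^ DIM('a)"
  define G where "G = (\<lambda>y. LINT p|lborel. exp (\<i> * complex_of_real (- (p \<bullet> y))) * \<Phi> p)"
  have [measurable]: "F \<in> borel_measurable borel" "\<Phi> \<in> borel_measurable borel" using F P by auto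
  have Gm [measurable]: "G \<in> borel_measurable borel" unfolding G_def by measurable
  define e where "e = (\<lambda>n. 1 / real (Suc n))"
  have e0: "e \<longlonglongrightarrow> 0" and e: "e n > 0" for n
    unfolding e_def by (rule LIMSEQ_Suc[OF lim_1_over_n]) simp
  define L where "L = (\<lambda>n y. LINT p|lborel. exp (\<i> * complex_of_real (- (p \<bullet> y))) * complex_of_real (gaussian (e n *\<^sub>R p)) * \<Phi> p)"
  have Lm [measurable]: "L n \<in> borel_measurable borel" for n unfolding L_def by measurable
  have Lb: "norm (L n y) \<le> (LINT p|lborel. norm (\<Phi> p))" for n y
    unfolding L_def
    by (rule Bochner_Integration.integral_norm_bound_integral) 
       (use P gaussian_bounds in \<open>auto simp: norm_mult norm_exp_i_times less_imp_le intro!: mult_left_le_one_le AE_I2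
          Bochner_Integration.integrable_bound[OF P]\<close>)
  have Gb: "norm (G y) \<le> (LINT p|lborel. norm (\<Phi> p))" for y
    unfolding G_def by (rule order_trans[OF integral_norm_bound]) (simp add: norm_mult norm_exp_i_times)
  have Ll: "(\<lambda>n. L n y) \<longlonglongrightarrow> G y" for y
    unfolding L_def G_def
  proof (rule integral_dominated_convergence[where w="\<lambda>p. norm (\<Phi> p)"])
    show "AE p in lborel. (\<lambda>n. exp (\<i> * complex_of_real (- (p \<bullet> y))) * complex_of_real (gaussian (e n *\<^sub>R p)) * \<Phi> p) \<longlonglongrightarrow> exp (\<i> * complex_of_real (- (p \<bullet> y))) * \<Phi> p"
    proof (rule AE_I2)
      fix p :: 'a
      have "(\<lambda>n. gaussian (e n *\<^sub>R p)) \<longlonglongrightarrow> gaussian (0 *\<^sub>R p)"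
        unfolding gaussian_def by (intro tendsto_intros e0) simp
      then have "(\<lambda>n. gaussian (e n *\<^sub>R p)) \<longlonglongrightarrow> 1" by (simp add: gaussian_def)
      then have "(\<lambda>n. exp (\<i> * complex_of_real (- (p \<bullet> y))) * complex_of_real (gaussian (e n *\<^sub>R p)) * \<Phi> p) \<longlonglongrightarrow> exp (\<i> * complex_of_real (- (p \<bullet> y))) * complex_of_real 1 * \<Phi> p"
        by (intro tendsto_intros)
      then show "(\<lambda>n. exp (\<i> * complex_of_real (- (p \<bullet> y))) * complex_of_real (gaussian (e n *\<^sub>R p)) * \<Phi> p) \<longlonglongrightarrow> exp (\<i> * complex_of_real (- (p \<bullet> y))) * \<Phi> p"
        by simp
    qed
  qed (use P gaussian_bounds in \<open>auto simp: norm_mult norm_exp_i_times less_imp_le intro!: mult_left_le_one_le AE_I2\<close>)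
  have boxfin: "integrable lborel (\<lambda>y. indicator (box a b) y *\<^sub>R C)" for a b :: 'a and C :: real
    by (intro integrable_scaleR_left integrable_real_indicator) (use emeasure_lborel_box_finite in auto)
  have boxeq: "(LINT y|lborel. indicator (box a b) y *\<^sub>R G y)
      = complex_of_real (?s * ?s) * (LINT y|lborel. indicator (box a b) y *\<^sub>R F y)" for a b
  proof (rule LIMSEQ_unique)
    let ?B = "indicator (box a b) :: 'a \<Rightarrow> real"
    show "(\<lambda>n. LINT y|lborel. ?B y *\<^sub>R L n y) \<longlonglongrightarrow> (LINT y|lborel. ?B y *\<^sub>R G y)"
    proof (rule integral_dominated_convergence[where w="\<lambda>y. ?B y *\<^sub>R (LINT p|lborel. norm (\<Phi> p))"])
      show "AE y in lborel. (\<lambda>n. ?B y *\<^sub>R L n y) \<longlonglongrightarrow> ?B y *\<^sub>R G y"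
        by (intro AE_I2 tendsto_intros Ll)
      show "AE y in lborel. norm (?B y *\<^sub>R L n y) \<le> ?B y *\<^sub>R (LINT p|lborel. norm (\<Phi> p))" for n
        by (auto simp: indicator_def Lb)
    qed (use boxfin in auto)
    have "(LINT y|lborel. ?B y *\<^sub>R L n y) = complex_of_real ?s *
       (LINT z|lborel. complex_of_real (gaussian z) * (LINT y|lborel. ?B (y - e n *\<^sub>R z) *\<^sub>R F y))" for n
    proof -
      have L: "L n y = complex_of_real ?s * (LINT z|lborel. F (y + e n *\<^sub>R z) * complex_of_real (gaussian z))" for y
        unfolding L_def \<Phi>_def by (rule gaussian_summability[OF F e])
      \<comment> \<open>exchange the Gaussian average with the integral over the box\<close>
      let ?h = "\<lambda>(z, y). complex_of_real (gaussian z) * ?B y *\<^sub>R F (y + e n *\<^sub>R z)"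
      have sh: "integrable lborel (\<lambda>y. F (y + v))" "(LINT y|lborel. norm (F (y + v))) = (LINT y|lborel. norm (F y))" for v
        using integral_affine(2)[of 1 F v] integral_affine(1)[of 1 "\<lambda>y. norm (F y)" v] F by (auto simp: add.commute)
      have i1: "integrable lborel (\<lambda>y. ?B y *\<^sub>R F (y + v))" for v
        by (rule Bochner_Integration.integrable_bound[OF sh(1)[of v]]) (auto simp: indicator_def)
      have "integrable (lborel \<Otimes>\<^sub>M lborel) ?h"
      proof (rule lborel_pair.Fubini_integrable)
        show "?h \<in> borel_measurable (lborel \<Otimes>\<^sub>M lborel)" by measurable
        show "AE z in lborel. integrable lborel (\<lambda>y. ?h (z, y))"
          using i1 by (simp del: mult_scaleR_right)
        have "norm (LINT y|lborel. norm (?h (z, y))) \<le> norm (gaussian z * (LINT y|lborel. norm (F y)))" for z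
        proof -
          have "(LINT y|lborel. norm (?h (z, y))) = gaussian z * (LINT y|lborel. norm (?B y *\<^sub>R F (y + e n *\<^sub>R z)))"
            by (subst integral_mult_right_zero[symmetric]) (simp add: norm_mult mult.left_commute)
          also have "\<dots> \<le> gaussian z * (LINT y|lborel. norm (F (y + e n *\<^sub>R z)))"
            using gaussian_bounds(1)[of z] i1 sh(1)
            by (intro mult_left_mono integral_mono integrable_norm) (auto simp: indicator_def)
          finally show ?thesis unfolding sh by simp
        qed
        then show "integrable lborel (\<lambda>z. LINT y|lborel. norm (?h (z, y)))"
          by (intro Bochner_Integration.integrable_bound[OF integrable_mult_left[OF gaussian_integral(1), of "LINT y|lborel. norm (F y)"]]) 
             (auto intro!: AE_I2)
      qed
      from lborel_pair.Fubini_integral[OF this]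
      have "(LINT y|lborel. LINT z|lborel. ?h (z, y)) = (LINT z|lborel. LINT y|lborel. ?h (z, y))" by simp
      moreover have "(LINT z|lborel. ?h (z, y)) = ?B y *\<^sub>R (LINT z|lborel. F (y + e n *\<^sub>R z) * complex_of_real (gaussian z))" for y
        by (subst integral_scaleR_right[symmetric]) (simp add: mult.commute)
      moreover have "(LINT y|lborel. ?h (z, y)) = complex_of_real (gaussian z) * (LINT y|lborel. ?B (y - e n *\<^sub>R z) *\<^sub>R F y)" for z
      proof -
        have "(LINT y|lborel. ?h (z, y)) = complex_of_real (gaussian z) * (LINT y|lborel. ?B y *\<^sub>R F (y + e n *\<^sub>R z))"
          by (subst integral_mult_right_zero[symmetric]) simp
        also have "(LINT y|lborel. ?B y *\<^sub>R F (y + e n *\<^sub>R z)) = (LINT y|lborel. ?B (y - e n *\<^sub>R z) *\<^sub>R F y)"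
          using integral_affine(1)[of 1 "\<lambda>y. ?B (y - e n *\<^sub>R z) *\<^sub>R F y" "e n *\<^sub>R z"] by (simp add: add.commute)
        finally show ?thesis .
      qed
      ultimately have "(LINT y|lborel. ?B y *\<^sub>R (LINT z|lborel. F (y + e n *\<^sub>R z) * complex_of_real (gaussian z)))
          = (LINT z|lborel. complex_of_real (gaussian z) * (LINT y|lborel. ?B (y - e n *\<^sub>R z) *\<^sub>R F y))"
        by (simp only:)
      moreover have "(LINT y|lborel. ?B y *\<^sub>R L n y) = complex_of_real ?s *
          (LINT y|lborel. ?B y *\<^sub>R (LINT z|lborel. F (y + e n *\<^sub>R z) * complex_of_real (gaussian z)))"
        unfolding L by (subst integral_mult_right_zero[symmetric]) simp
      ultimately show ?thesis by simp
    qed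
    moreover have "(\<lambda>n. LINT z|lborel. complex_of_real (gaussian z) * (LINT y|lborel. ?B (y - e n *\<^sub>R z) *\<^sub>R F y))
       \<longlonglongrightarrow> (LINT z|lborel. complex_of_real (gaussian (z::'a)) * (LINT y|lborel. ?B y *\<^sub>R F y))"
    proof (rule integral_dominated_convergence[where w="\<lambda>z. gaussian z * (LINT y|lborel. norm (F y))"])
      show "integrable lborel (\<lambda>z::'a. gaussian z * (LINT y|lborel. norm (F y)))"
        by (intro integrable_mult_left gaussian_integral)
      show "AE z in lborel. (\<lambda>n. complex_of_real (gaussian z) * (LINT y|lborel. ?B (y - e n *\<^sub>R z) *\<^sub>R F y))
         \<longlonglongrightarrow> complex_of_real (gaussian z) * (LINT y|lborel. ?B y *\<^sub>R F y)"
        by (intro AE_I2 tendsto_intros box_integral_translate_tendsto[OF F e0])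
      have "norm (LINT y|lborel. ?B (y - v) *\<^sub>R F y) \<le> (LINT y|lborel. norm (F y))" for v
        by (rule Bochner_Integration.integral_norm_bound_integral) (use F in \<open>auto simp: indicator_def intro!: Bochner_Integration.integrable_bound[OF F]\<close>)
      then show "AE z in lborel. norm (complex_of_real (gaussian z) * (LINT y|lborel. ?B (y - e n *\<^sub>R z) *\<^sub>R F y))
          \<le> gaussian z * (LINT y|lborel. norm (F y))" for n
        using gaussian_bounds(1) by (auto simp: norm_mult abs_of_pos intro!: mult_left_mono)
    qed measurable
    then have "(\<lambda>n. complex_of_real ?s * (LINT z|lborel. complex_of_real (gaussian z) * (LINT y|lborel. ?B (y - e n *\<^sub>R z) *\<^sub>R F y)))
       \<longlonglongrightarrow> complex_of_real ?s * (complex_of_real ?s * (LINT y|lborel. ?B y *\<^sub>R F y))"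
      by (intro tendsto_mult tendsto_const) (simp add: gaussian_integral)
    ultimately show "(\<lambda>n. LINT y|lborel. ?B y *\<^sub>R L n y)
       \<longlonglongrightarrow> complex_of_real (?s * ?s) * (LINT y|lborel. ?B y *\<^sub>R F y)"
      by (simp add: mult.assoc)
  qed
  have ss: "?s * ?s = (2 * pi) ^ DIM('a)" 
  proof -
    have "?s * ?s = (sqrt (2 * pi) * sqrt (2 * pi)) ^ DIM('a)" by (rule power_mult_distrib[symmetric])
    also have "sqrt (2 * pi) * sqrt (2 * pi) = 2 * pi" by (rule real_sqrt_mult_self[THEN trans]) simp
    finally show ?thesis .
  qed
  let ?H = "\<lambda>y. (2 * pi) ^ DIM('a) *\<^sub>R F y - G y"
  have iF: "integrable lborel (\<lambda>y. indicator (box a b) y *\<^sub>R F y)" for a b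
    by (rule Bochner_Integration.integrable_bound[OF F]) (auto simp: indicator_def)
  have iG: "integrable lborel (\<lambda>y. indicator (box a b) y *\<^sub>R G y)" for a b
  proof (rule Bochner_Integration.integrable_bound[OF boxfin[of a b "LINT p|lborel. norm (\<Phi> p)"]])
    show "AE y in lborel. norm (indicator (box a b) y *\<^sub>R G y)
        \<le> norm (indicator (box a b) y *\<^sub>R (LINT p|lborel. norm (\<Phi> p)))"
      using Gb by (intro AE_I2) (simp add: indicator_def)
  qed measurable
  have "AE y in lborel. ?H y = 0"
  proof (rule AE_zero_if_box_integrals_zero)
    have e: "indicator (box a b) y *\<^sub>R ?H y = (2 * pi) ^ DIM('a) *\<^sub>R (indicator (box a b) y *\<^sub>R F y) - indicator (box a b) y *\<^sub>R G y" for a b y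
      by (simp add: indicator_def)
    show "set_integrable lborel (box a b) ?H" for a b
      unfolding set_integrable_def e
      by (intro Bochner_Integration.integrable_diff integrable_scaleR_right iF iG)
    show "(LINT y:box a b|lborel. ?H y) = 0" for a b
    proof -
      have "(LINT y:box a b|lborel. ?H y) = (2 * pi) ^ DIM('a) *\<^sub>R (LINT y|lborel. indicator (box a b) y *\<^sub>R F y)
          - (LINT y|lborel. indicator (box a b) y *\<^sub>R G y)"
        unfolding set_lebesgue_integral_def e
        by (simp only: Bochner_Integration.integral_diff[OF integrable_scaleR_right[OF iF] iG] integral_scaleR_right)
      then show ?thesis unfolding boxeq ss by (simp add: scaleR_conv_of_real)
    qed
  qed measurable
  then show ?thesis unfolding G_def by simp
qed

section \<open>Symmetric differences of measurable functions\<close>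

lemma emeasure_lborel_vimage_translation:
  fixes A :: "'a::euclidean_space set"
  assumes "A \<in> sets borel"
  shows "emeasure lborel ((\<lambda>x. x + v) -` A) = emeasure lborel A"
proof -
  have "emeasure lborel A = emeasure (distr lborel borel ((+) v)) A"
    by (simp add: lborel_distr_plus)
  also have "\<dots> = emeasure lborel ((\<lambda>x. x + v) -` A)"
    using assms by (subst emeasure_distr) (auto simp: add.commute vimage_def)
  finally show ?thesis by simp
qed

text \<open>
  A symmetric variant of Steinhaus' theorem. Choose a compact \<open>K \<subseteq> N\<close> of positive measure
  and an open \<open>U \<supseteq> K\<close> that exceeds it by less than half of the measure of \<open>K\<close>. If \<open>y\<close> is shorter than the
  distance of \<open>K\<close> to the complement of \<open>U\<close>, a shift by \<open>y\<close> moves less than half of \<open>K\<close> out of \<open>K\<close>,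
  and likewise for \<open>- y\<close>. So the two shifts cannot exhaust \<open>K\<close>.
\<close>

lemma symmetric_translates_meet:
  fixes N :: "'a::euclidean_space set"
  assumes N [measurable]: "N \<in> sets borel" and pos: "emeasure lborel N > 0"
  obtains r where "r > 0"
    "\<And>y. norm y < r \<Longrightarrow> emeasure lborel {x \<in> N. x + y \<in> N \<and> x - y \<in> N} > 0"
proof -
  obtain K where K: "compact K" "K \<subseteq> N" "emeasure lborel K > 0"
  proof -
    have "N = (\<Union>n::nat. N \<inter> cball 0 (real n))"
      by (auto simp: real_arch_simple)
    then obtain n :: nat where n: "emeasure lborel (N \<inter> cball 0 (real n)) > 0"
    proof -
      have "\<not> (\<forall>n::nat. N \<inter> cball 0 (real n) \<in> null_sets lborel)"
      proof
        assume "\<forall>n::nat. N \<inter> cball 0 (real n) \<in> null_sets lborel"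
        then have "(\<Union>n::nat. N \<inter> cball 0 (real n)) \<in> null_sets lborel" by (intro null_sets_UN) auto
        then show False using \<open>N = _\<close> pos by (metis null_setsD1 less_irrefl)
      qed
      then obtain n :: nat where "N \<inter> cball 0 (real n) \<notin> null_sets lborel" by auto
      moreover have "N \<inter> cball 0 (real n) \<in> sets lborel" by simp
      ultimately show ?thesis using that by (auto simp: null_sets_def zero_less_iff_neq_zero)
    qed
    let ?S = "N \<inter> cball 0 (real n)"
    have fin: "emeasure lborel ?S < \<infinity>"
      by (rule le_less_trans[OF emeasure_mono[of _ "cball 0 (real n)"] emeasure_lborel_cball_finite]) auto
    \<comment> \<open>any positive number below the measure of the bounded piece would do\<close>
    define e where "e = measure lborel ?S / 2"
    have "emeasure lborel ?S = ennreal (measure lborel ?S)"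
      using fin by (simp add: emeasure_eq_ennreal_measure)
    moreover from this n have "measure lborel ?S > 0" by (simp add: ennreal_zero_less_mult_iff)
    ultimately have e: "0 < e" "ennreal e < emeasure lborel ?S"
      by (simp_all add: e_def ennreal_lessI)
    obtain T where T: "closed T" "T \<subseteq> ?S" "?S - T \<in> lmeasurable" "emeasure lebesgue (?S - T) < ennreal e"
      using sets_lebesgue_inner_closed[of ?S e] e(1) by auto
    have Tb: "T \<in> sets borel" using T(1) by auto
    have "emeasure lborel T \<noteq> 0"
    proof
      assume "emeasure lborel T = 0"
      have "emeasure lborel ?S \<le> emeasure lborel (T \<union> (?S - T))" using Tb by (intro emeasure_mono) auto
      also have "\<dots> \<le> emeasure lborel T + emeasure lborel (?S - T)" using Tb by (intro emeasure_subadditive) auto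
      also have "\<dots> = emeasure lebesgue (?S - T)" using Tb \<open>emeasure lborel T = 0\<close> by simp
      finally show False using T(4) e(2) by (meson leD less_trans)
    qed
    moreover have "compact T" using T(1,2) by (meson bounded_Int bounded_cball bounded_subset compact_eq_bounded_closed)
    ultimately show ?thesis using that[of T] T(2) by (auto simp: zero_less_iff_neq_zero)
  qed
  have Kb [measurable]: "K \<in> sets borel" using K(1) by (simp add: borel_compact)
  have Kfin: "emeasure lborel K < \<infinity>" using K(1) by (rule emeasure_compact_finite)
  define m where "m = measure lborel K"
  have m1: "emeasure lborel K = ennreal m"
    unfolding m_def using Kfin by (simp add: emeasure_eq_ennreal_measure)
  moreover have "m > 0" using K(3) unfolding m1 by simp
  ultimately have m: "emeasure lborel K = ennreal m" "m > 0" .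
  obtain U where U: "open U" "K \<subseteq> U" "U - K \<in> lmeasurable" "emeasure lebesgue (U - K) < ennreal (m / 2)"
    using sets_lebesgue_outer_open[of K "m / 2"] m(2) by auto
  obtain r where r: "r > 0" "(\<Union>x\<in>K. ball x r) \<subseteq> U"
    using compact_subset_open_imp_ball_epsilon_subset[OF K(1) U(1,2)] .
  have Ub [measurable]: "U \<in> sets borel" using U(1) by auto
  show ?thesis
  proof (rule that[OF r(1)])
    fix y :: 'a assume y: "norm y < r"
    define D where "D = (\<lambda>v::'a. K - (\<lambda>x. x + v) -` K)"
    have Dm [measurable]: "D v \<in> sets borel" for v unfolding D_def
      by (intro sets.Diff Kb) (rule measurable_sets_borel[OF _ Kb], simp)
    \<comment> \<open>the part of K that a shift moves out of K is carried into U - K\<close>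
    have shift: "emeasure lborel (D v) < ennreal (m / 2)" if "norm v < r" for v
    proof -
      have "(\<lambda>x. x + v) -` (U - K) \<in> sets borel" by (rule measurable_sets_borel[of _ borel]) auto
      moreover have "D v \<subseteq> (\<lambda>x. x + v) -` (U - K)"
      proof
        fix x assume "x \<in> D v"
        then have "x \<in> K" "x + v \<notin> K" by (auto simp: D_def)
        moreover have "x + v \<in> ball x r" using that by (simp add: dist_norm)
        ultimately show "x \<in> (\<lambda>x. x + v) -` (U - K)" using r(2) by blast
      qed
      ultimately have "emeasure lborel (D v) \<le> emeasure lborel ((\<lambda>x. x + v) -` (U - K))"
        by (intro emeasure_mono) auto
      also have "\<dots> = emeasure lborel (U - K)" by (rule emeasure_lborel_vimage_translation) auto
      finally show ?thesis using U(4) by simp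
    qed
    let ?E = "{x \<in> N. x + y \<in> N \<and> x - y \<in> N}"
    have Em: "?E \<in> sets borel" by measurable
    show "emeasure lborel ?E > 0"
    proof (rule ccontr)
      assume "\<not> ?thesis"
      then have E0: "emeasure lborel ?E = 0" by simp
      have "K \<subseteq> ?E \<union> (D y \<union> D (- y))" using K(2) by (auto simp: D_def)
      then have "emeasure lborel K \<le> emeasure lborel (?E \<union> (D y \<union> D (- y)))"
        using Em by (intro emeasure_mono) auto
      also have "\<dots> \<le> emeasure lborel ?E + emeasure lborel (D y \<union> D (- y))"
        using Em by (intro emeasure_subadditive) auto
      also have "\<dots> \<le> emeasure lborel ?E + (emeasure lborel (D y) + emeasure lborel (D (- y)))"
        by (intro add_left_mono emeasure_subadditive) auto
      also have "\<dots> < ennreal (m / 2) + ennreal (m / 2)"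
        using shift[of y] shift[of "- y"] y E0 by (simp add: add_strict_mono)
      also have "\<dots> = ennreal m" using m(2) by (simp flip: ennreal_plus)
      finally show False using m(1) by simp
    qed
  qed
qed

text \<open>
  Cut the range of \<open>V\<close> into countably many intervals of length \<open>\<epsilon>\<close>. If the exceptional points \<open>x\<close>
  with \<open>V x\<close> in one of these intervals formed a set \<open>N\<close> of positive measure, then for all small \<open>y\<close>
  many \<open>x \<in> N\<close> would have both \<open>x \<plusminus> y/2\<close> in \<open>N\<close>, where the values of \<open>V\<close> differ by less than \<open>\<epsilon>\<close>.
  By Fubini some exceptional \<open>x\<close> would then admit a set of such \<open>y\<close> of positive measure.
\<close>

lemma AE_symmetric_difference_small:
  fixes V :: "'a::euclidean_space \<Rightarrow> real"
  assumes [measurable]: "V \<in> borel_measurable borel" and e: "\<epsilon> > 0" and d: "\<delta> > 0"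
  shows "AE x in lborel. emeasure lborel {y \<in> ball 0 \<delta>. \<bar>V (x + y /\<^sub>R 2) - V (x - y /\<^sub>R 2)\<bar> < \<epsilon>} > 0"
proof -
  define S where "S = (\<lambda>x. {y \<in> ball 0 \<delta>. \<bar>V (x + y /\<^sub>R 2) - V (x - y /\<^sub>R 2)\<bar> < \<epsilon>})"
  define Q where "Q = {z::'a \<times> 'a. snd z \<in> ball 0 \<delta> \<and> \<bar>V (fst z + snd z /\<^sub>R 2) - V (fst z - snd z /\<^sub>R 2)\<bar> < \<epsilon>}"
  have Q: "Q \<in> sets (lborel \<Otimes>\<^sub>M lborel)"
  proof -
    let ?D = "\<lambda>z::'a \<times> 'a. \<bar>V (fst z + snd z /\<^sub>R 2) - V (fst z - snd z /\<^sub>R 2)\<bar>"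
    have "?D \<in> borel_measurable borel"
      by (intro borel_measurable_abs borel_measurable_diff
          measurable_compose[OF borel_measurable_continuous_onI assms(1)] continuous_intros)
    from measurable_sets_borel[OF this, of "{..<\<epsilon>}"]
    have "?D -` {..<\<epsilon>} \<in> sets borel" by simp
    moreover have "snd -` ball (0::'a) \<delta> \<in> sets (borel :: ('a \<times> 'a) measure)"
      by (intro borel_open open_vimage_snd) simp
    moreover have "Q = snd -` ball 0 \<delta> \<inter> ?D -` {..<\<epsilon>}"
      by (auto simp: Q_def)
    ultimately have "Q \<in> sets borel" by (simp only: sets.Int)
    then show ?thesis by (simp only: lborel_prod sets_lborel)
  qed
  have "(\<lambda>x. emeasure lborel (Pair x -` Q)) \<in> borel_measurable lborel"
    using lborel.measurable_emeasure_Pair[OF Q] .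
  moreover have "Pair x -` Q = S x" for x by (auto simp: Q_def S_def)
  ultimately have Sm [measurable]: "(\<lambda>x. emeasure lborel (S x)) \<in> borel_measurable borel" by simp
  have Sb: "S x \<in> sets borel" for x unfolding S_def by measurable
  define N where "N = (\<lambda>k::int. {x. emeasure lborel (S x) = 0 \<and> \<lfloor>V x / \<epsilon>\<rfloor> = k})"
  have Nb [measurable]: "N k \<in> sets borel" for k unfolding N_def by measurable
  have "N k \<in> null_sets lborel" for k
  proof (rule ccontr)
    assume "N k \<notin> null_sets lborel"
    then have "emeasure lborel (N k) > 0" by (auto simp: null_sets_def zero_less_iff_neq_zero)
    then obtain r where r: "r > 0"
      "\<And>y. norm y < r \<Longrightarrow> emeasure lborel {x \<in> N k. x + y \<in> N k \<and> x - y \<in> N k} > 0"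
      using symmetric_translates_meet[OF Nb] by blast
    define P where "P = {z::'a\<times>'a. fst z \<in> N k \<and> fst z + snd z /\<^sub>R 2 \<in> N k \<and> fst z - snd z /\<^sub>R 2 \<in> N k \<and> snd z \<in> ball 0 \<delta>}"
    have Pm: "P \<in> sets (lborel \<Otimes>\<^sub>M lborel)" 
    proof -
      have v: "f -` N k \<in> sets borel" if "continuous_on UNIV f" for f :: "'a \<times> 'a \<Rightarrow> 'a"
        by (rule measurable_sets_borel[OF borel_measurable_continuous_onI[OF that] Nb])
      have "fst -` N k \<inter> (\<lambda>z::'a\<times>'a. fst z + snd z /\<^sub>R 2) -` N k
          \<inter> (\<lambda>z::'a\<times>'a. fst z - snd z /\<^sub>R 2) -` N k \<inter> snd -` ball 0 \<delta> \<in> sets borel"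
        by (intro sets.Int v borel_open open_vimage_snd continuous_intros) simp
      moreover have "P = fst -` N k \<inter> (\<lambda>z::'a\<times>'a. fst z + snd z /\<^sub>R 2) -` N k
          \<inter> (\<lambda>z::'a\<times>'a. fst z - snd z /\<^sub>R 2) -` N k \<inter> snd -` ball 0 \<delta>"
        by (auto simp: P_def)
      ultimately have "P \<in> sets borel" by (simp only:)
      then show ?thesis by (simp only: lborel_prod sets_lborel)
    qed
    have sub: "Pair x -` P \<subseteq> (if x \<in> N k then S x else {})" for x
    proof
      fix y assume y: "y \<in> Pair x -` P"
      then have "x \<in> N k" "\<lfloor>V (x + y /\<^sub>R 2) / \<epsilon>\<rfloor> = k" "\<lfloor>V (x - y /\<^sub>R 2) / \<epsilon>\<rfloor> = k" "y \<in> ball 0 \<delta>"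
        by (auto simp: P_def N_def)
      then have "\<bar>V (x + y /\<^sub>R 2) / \<epsilon> - V (x - y /\<^sub>R 2) / \<epsilon>\<bar> < 1" by linarith
      then have "\<bar>V (x + y /\<^sub>R 2) - V (x - y /\<^sub>R 2)\<bar> < \<epsilon>"
        using e by (simp add: diff_divide_distrib[symmetric] abs_divide)
      then show "y \<in> (if x \<in> N k then S x else {})" using \<open>x \<in> N k\<close> \<open>y \<in> ball 0 \<delta>\<close> by (simp add: S_def)
    qed
    have "emeasure lborel (Pair x -` P) \<le> emeasure lborel (if x \<in> N k then S x else {})" for x
      using sub Sb by (intro emeasure_mono) auto
    then have "emeasure lborel (Pair x -` P) = 0" for x
      by (smt (verit, ccfv_threshold) N_def emeasure_empty mem_Collect_eq le_zero_eq)
    then have "emeasure (lborel \<Otimes>\<^sub>M lborel) P = 0"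
      by (subst lborel.emeasure_pair_measure_alt[OF Pm]) simp
    then have "(\<integral>\<^sup>+y. emeasure lborel ((\<lambda>x. (x, y)) -` P) \<partial>lborel) = 0"
      using lborel_pair.emeasure_pair_measure_alt2[OF Pm] by simp
    then have ae: "AE y in lborel. emeasure lborel ((\<lambda>x. (x, y)) -` P) = 0"
      using lborel_pair.measurable_emeasure_Pair2[OF Pm] by (subst (asm) nn_integral_0_iff_AE) auto
    have "AE y in lborel. y \<notin> ball (0::'a) (min \<delta> r)"
      using ae
    proof eventually_elim
      case (elim y)
      show ?case
      proof
        assume y: "y \<in> ball 0 (min \<delta> r)"
        then have "norm y < r * 2" using r(1) by (simp add: less_le_trans[of "norm y" r])
        then have "norm (y /\<^sub>R 2) < r" by simp
        then have "emeasure lborel {x \<in> N k. x + y /\<^sub>R 2 \<in> N k \<and> x - y /\<^sub>R 2 \<in> N k} > 0" by (rule r(2))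
        moreover have "(\<lambda>x. (x, y)) -` P = {x \<in> N k. x + y /\<^sub>R 2 \<in> N k \<and> x - y /\<^sub>R 2 \<in> N k}"
          using y by (auto simp: P_def)
        ultimately show False using elim by simp
      qed
    qed
    then have "ball (0::'a) (min \<delta> r) \<in> null_sets lborel"
      by (subst (asm) AE_iff_null_sets[symmetric]) auto
    then have "negligible (ball (0::'a) (min \<delta> r))"
      by (simp add: negligible_iff_null_sets null_sets_completionI)
    then show False using open_not_negligible[of "ball (0::'a) (min \<delta> r)"] d r(1) by auto
  qed
  then have "(\<Union>k. N k) \<in> null_sets lborel" by (intro null_sets_UN') auto
  then have "AE x in lborel. x \<notin> (\<Union>k. N k)" by (rule AE_not_in)
  then show ?thesis
    by eventually_elim (auto simp: N_def S_def zero_less_iff_neq_zero)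
qed

section \<open>The potential operator\<close>

definition potential_difference :: "('a::real_vector \<Rightarrow> real) \<Rightarrow> 'a \<Rightarrow> 'a \<Rightarrow> real" where
  "potential_difference V x y = V (x + y /\<^sub>R 2) - V (x - y /\<^sub>R 2)"

definition momentum_fourier :: "('a \<times> 'b::euclidean_space \<Rightarrow> complex) \<Rightarrow> 'a \<Rightarrow> 'b \<Rightarrow> complex" where
  "momentum_fourier w x y = (LINT p|lborel. exp (\<i> * complex_of_real (- (p \<bullet> y))) * w (x, p))"

text \<open>
  For fixed \<open>x\<close>, the function of \<open>y\<close> whose Fourier transform is \<open>\<Theta>[V]w(x,\<cdot>)\<close> up to a constant factor.
\<close>

definition Theta_symbol :: "(real ^ 'd \<Rightarrow> real) \<Rightarrow> ('d::finite phase \<Rightarrow> complex) \<Rightarrow> real ^ 'd \<Rightarrow> real ^ 'd \<Rightarrow> complex" where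
  "Theta_symbol V w x y = complex_of_real (potential_difference V x y) * momentum_fourier w x y"

lemma Theta_integrand_integral:
  "(LINT p'|lborel. Theta_integrand V w x p y p') = exp (\<i> * complex_of_real (p \<bullet> y)) * Theta_symbol V w x y"
proof -
  have "Theta_integrand V w x p y p' = exp (\<i> * complex_of_real (p \<bullet> y)) * complex_of_real (potential_difference V x y)
      * (exp (\<i> * complex_of_real (- (p' \<bullet> y))) * w (x, p'))" for p'
  proof -
    have "exp (\<i> * complex_of_real ((p - p') \<bullet> y))
        = exp (\<i> * complex_of_real (p \<bullet> y)) * exp (\<i> * complex_of_real (- (p' \<bullet> y)))"
      by (simp add: exp_add[symmetric] inner_diff_left right_diff_distrib)
    then show ?thesis by (simp only: Theta_integrand_def potential_difference_def mult_ac)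
  qed
  then show ?thesis by (simp add: Theta_symbol_def momentum_fourier_def mult.assoc)
qed

lemma Theta_eq:
  "Theta V w (x, p) = - (\<i> / complex_of_real ((2 * pi) ^ CARD('d))) *
     (LINT y|lborel. exp (\<i> * complex_of_real (p \<bullet> y)) * Theta_symbol V w x y)"
  for V :: "real ^ 'd::finite \<Rightarrow> real"
  unfolding Theta_def Theta_integrand_integral by simp

text \<open>
  This is the convergence condition at \<open>p = 0\<close>, where the oscillating factor is \<open>1\<close>.
\<close>

lemma integrable_Theta_symbol:
  assumes "Theta_converges V w"
  shows "integrable lborel (Theta_symbol V w x)"
proof -
  have "integrable lborel (\<lambda>y. LINT p'|lborel. Theta_integrand V w x 0 y p')"
    using assms by (auto simp: Theta_converges_def)
  then show ?thesis unfolding Theta_integrand_integral by simp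
qed

lemma norm_momentum_fourier_le:
  "cmod (momentum_fourier w x y) \<le> (LINT p|lborel. cmod (w (x, p)))"
  unfolding momentum_fourier_def
  by (rule order_trans[OF integral_norm_bound]) (simp add: norm_mult)

text \<open>
  The integral is a multiple of the value at \<open>0\<close> of the continuous representative of
  \<open>Theta_symbol V w x\<close>. A set of positive measure contains points at which the symbol equals that
  representative. By hypothesis, such points can be found arbitrarily close to \<open>0\<close> with an
  arbitrarily small potential difference, and the momentum transform is bounded.
\<close>

lemma fibre_integral_Theta:
  fixes V :: "real ^ 'd::finite \<Rightarrow> real" and x :: "real ^ 'd"
  assumes conv: "Theta_converges V w"
    and T: "integrable lborel (\<lambda>p. Theta V w (x, p))"
    and near: "\<And>n. emeasure lborel {y \<in> ball 0 (1 / real (Suc n)). \<bar>V (x + y /\<^sub>R 2) - V (x - y /\<^sub>R 2)\<bar> < 1 / real (Suc n)} > 0"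
  shows "(LINT p|lborel. Theta V w (x, p)) = 0"
proof -
  let ?c = "(2 * pi) ^ CARD('d)"
  define \<Phi> where "\<Phi> = (\<lambda>p. LINT y|lborel. exp (\<i> * complex_of_real (p \<bullet> y)) * Theta_symbol V w x y)"
  have Th: "Theta V w (x, p) = - (\<i> / complex_of_real ?c) * \<Phi> p" for p
    unfolding Theta_eq \<Phi>_def ..
  have P: "integrable lborel \<Phi>"
  proof -
    have "integrable lborel (\<lambda>p. (\<i> * complex_of_real ?c) * Theta V w (x, p))"
      using T by (intro integrable_mult_right)
    moreover have "(\<i> * complex_of_real ?c) * Theta V w (x, p) = \<Phi> p" for p
      unfolding Th by (simp add: field_simps)
    ultimately show ?thesis by simp
  qed
  have inv: "AE y in lborel. ?c *\<^sub>R Theta_symbol V w x y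
      = (LINT p|lborel. exp (\<i> * complex_of_real (- (p \<bullet> y))) * \<Phi> p)"
    using fourier_inversion_AE[OF integrable_Theta_symbol[OF conv, of x]] P unfolding \<Phi>_def by simp
  define S where "S = (\<lambda>n. {y \<in> ball 0 (1 / real (Suc n)). \<bar>V (x + y /\<^sub>R 2) - V (x - y /\<^sub>R 2)\<bar> < 1 / real (Suc n)})"
  have Spos: "emeasure lborel (S n) > 0" for n
    using near[of n] by (simp only: S_def)
  have "\<exists>y. y \<in> S n \<and>
      ?c *\<^sub>R Theta_symbol V w x y = (LINT p|lborel. exp (\<i> * complex_of_real (- (p \<bullet> y))) * \<Phi> p)" for n
  proof (rule ccontr)
    assume "\<not> ?thesis"
    then have "AE y in lborel. y \<notin> S n" using inv by (auto elim!: eventually_mono)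
    moreover have "S n \<in> sets lborel"
      using Spos[of n] emeasure_notin_sets[of "S n" lborel] by (cases "S n \<in> sets lborel") simp_all
    ultimately have "S n \<in> null_sets lborel" by (simp add: AE_iff_null_sets)
    then show False using Spos[of n] by (simp add: null_sets_def)
  qed
  then have "\<forall>n. \<exists>y. y \<in> S n \<and>
      ?c *\<^sub>R Theta_symbol V w x y = (LINT p|lborel. exp (\<i> * complex_of_real (- (p \<bullet> y))) * \<Phi> p)" by blast
  from choice[OF this] obtain Y where Y0: "\<And>n. Y n \<in> S n" and
      Y3: "\<And>n. ?c *\<^sub>R Theta_symbol V w x (Y n) = (LINT p|lborel. exp (\<i> * complex_of_real (- (p \<bullet> Y n))) * \<Phi> p)"
    by blast
  have Y1: "norm (Y n) < 1 / real (Suc n)" and Y2: "\<bar>potential_difference V x (Y n)\<bar> < 1 / real (Suc n)" for n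
    using Y0[of n] unfolding S_def potential_difference_def by simp_all
  have inv0: "(\<lambda>n. 1 / real (Suc n)) \<longlonglongrightarrow> 0" by (rule LIMSEQ_Suc[OF lim_1_over_n])
  have "Y \<longlonglongrightarrow> 0"
    by (rule Lim_null_comparison[OF _ inv0]) (use Y1 in \<open>auto intro!: always_eventually less_imp_le\<close>)
  \<comment> \<open>along the chosen points the symbol equals the continuous function, whose value at 0 is the integral of the transform\<close>
  then have l1: "(\<lambda>n. ?c *\<^sub>R Theta_symbol V w x (Y n)) \<longlonglongrightarrow> (LINT p|lborel. \<Phi> p)"
    unfolding Y3 using fourier_continuous[OF P, of Y 0] by simp
  have l2: "(\<lambda>n. ?c *\<^sub>R Theta_symbol V w x (Y n)) \<longlonglongrightarrow> 0"
  proof (rule Lim_null_comparison)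
    let ?M = "LINT p|lborel. cmod (w (x, p))"
    show "\<forall>\<^sub>F n in sequentially. norm (?c *\<^sub>R Theta_symbol V w x (Y n)) \<le> ?c * (1 / real (Suc n) * ?M)"
    proof (rule always_eventually, rule allI)
      fix n
      have "cmod (Theta_symbol V w x (Y n)) \<le> 1 / real (Suc n) * ?M"
        unfolding Theta_symbol_def norm_mult norm_of_real
        using Y2[of n] norm_momentum_fourier_le[of w x "Y n"] by (intro mult_mono) auto
      then show "norm (?c *\<^sub>R Theta_symbol V w x (Y n)) \<le> ?c * (1 / real (Suc n) * ?M)"
        by (simp only: norm_scaleR) (intro mult_mono, auto)
    qed
    have "(\<lambda>n. ?c * (1 / real (Suc n) * ?M)) \<longlonglongrightarrow> ?c * (0 * ?M)"
      by (intro tendsto_mult tendsto_const inv0)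
    then show "(\<lambda>n. ?c * (1 / real (Suc n) * ?M)) \<longlonglongrightarrow> 0" by simp
  qed
  have "(LINT p|lborel. \<Phi> p) = 0" using LIMSEQ_unique[OF l1 l2] .
  then show ?thesis unfolding Th by simp
qed

lemma integral_Theta:
  fixes V :: "real ^ 'd::finite \<Rightarrow> real"
  assumes V: "V \<in> borel_measurable borel" and conv: "Theta_converges V w"
    and T: "integrable lborel (Theta V w)"
  shows "(LINT z|lborel. Theta V w z) = 0"
proof -
  have T': "integrable (lborel \<Otimes>\<^sub>M lborel) (Theta V w)" using T by (simp add: lborel_prod)
  have "AE x in lborel. \<forall>n. emeasure lborel
      {y \<in> ball 0 (1 / real (Suc n)). \<bar>V (x + y /\<^sub>R 2) - V (x - y /\<^sub>R 2)\<bar> < 1 / real (Suc n)} > 0"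
    unfolding AE_all_countable by (intro allI AE_symmetric_difference_small V) auto
  moreover note lborel_pair.AE_integrable_fst'[OF T']
  ultimately have "AE x in lborel. (LINT p|lborel. Theta V w (x, p)) = 0"
    by eventually_elim (rule fibre_integral_Theta[OF conv]; simp)
  then have "(LINT x|lborel. LINT p|lborel. Theta V w (x, p)) = 0"
    by (rule integral_eq_zero_AE)
  then show ?thesis using lborel_pair.integral_fst'[OF T'] by (simp add: lborel_prod)
qed

text \<open>
  By Fubini this is Parseval's identity: the integral equals a purely imaginary constant times
  the integral of \<open>potential_difference V x y\<close> times the squared modulus of the momentum transform.
\<close>

lemma fibre_energy_Theta:
  fixes V :: "real ^ 'd::finite \<Rightarrow> real" and x :: "real ^ 'd"
  assumes conv: "Theta_converges V u" and u: "integrable lborel (\<lambda>p. u (x, p))"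
  shows "Re (LINT p|lborel. cnj (u (x, p)) * Theta V u (x, p)) = 0"
proof -
  let ?c = "(2 * pi) ^ CARD('d)"
  have "(LINT p|lborel. cnj (u (x, p)) * Theta V u (x, p))
      = (LINT p|lborel. - (\<i> / complex_of_real ?c) * (cnj (u (x, p)) *
          (LINT y|lborel. exp (\<i> * complex_of_real (p \<bullet> y)) * Theta_symbol V u x y)))"
    unfolding Theta_eq by (simp add: mult_ac)
  also have "\<dots> = - (\<i> / complex_of_real ?c) * (LINT p|lborel. cnj (u (x, p)) *
          (LINT y|lborel. exp (\<i> * complex_of_real (p \<bullet> y)) * Theta_symbol V u x y))"
    by (rule integral_mult_right_zero)
  also have "(LINT p|lborel. cnj (u (x, p)) *
          (LINT y|lborel. exp (\<i> * complex_of_real (p \<bullet> y)) * Theta_symbol V u x y))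
     = (LINT y|lborel. Theta_symbol V u x y * (LINT p|lborel. exp (\<i> * complex_of_real (p \<bullet> y)) * cnj (u (x, p))))"
    by (rule fourier_multiplication_formula) (use u integrable_Theta_symbol[OF conv] in auto)
  also have "\<dots> = (LINT y|lborel. complex_of_real (potential_difference V x y * (cmod (momentum_fourier u x y))\<^sup>2))"
  proof (rule Bochner_Integration.integral_cong[OF refl])
    fix y
    have "(LINT p|lborel. exp (\<i> * complex_of_real (p \<bullet> y)) * cnj (u (x, p))) = cnj (momentum_fourier u x y)"
    proof -
      have "(LINT p|lborel. exp (\<i> * complex_of_real (p \<bullet> y)) * cnj (u (x, p)))
          = (LINT p|lborel. cnj (exp (\<i> * complex_of_real (- (p \<bullet> y))) * u (x, p)))"
        by (simp add: exp_cnj)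
      also have "\<dots> = cnj (momentum_fourier u x y)"
        unfolding momentum_fourier_def by (rule Bochner_Integration.integral_cnj)
      finally show ?thesis .
    qed
    then show "Theta_symbol V u x y * (LINT p|lborel. exp (\<i> * complex_of_real (p \<bullet> y)) * cnj (u (x, p)))
      = complex_of_real (potential_difference V x y * (cmod (momentum_fourier u x y))\<^sup>2)"
      unfolding Theta_symbol_def by (simp only: of_real_mult complex_norm_square mult_ac)
  qed
  finally show ?thesis unfolding integral_complex_of_real by simp
qed

lemma energy_Theta:
  fixes V :: "real ^ 'd::finite \<Rightarrow> real"
  assumes conv: "Theta_converges V u" and u: "integrable lborel u"
    and T: "integrable lborel (\<lambda>z. cnj (u z) * Theta V u z)"
  shows "Re (LINT z|lborel. cnj (u z) * Theta V u z) = 0"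
proof -
  have u': "integrable (lborel \<Otimes>\<^sub>M lborel) u" using u by (simp add: lborel_prod)
  have T': "integrable (lborel \<Otimes>\<^sub>M lborel) (\<lambda>z. cnj (u z) * Theta V u z)" using T by (simp add: lborel_prod)
  have "AE x in lborel. Re (LINT p|lborel. cnj (u (x, p)) * Theta V u (x, p)) = 0"
    using lborel_pair.AE_integrable_fst'[OF u'] by eventually_elim (rule fibre_energy_Theta[OF conv])
  then have "(LINT x|lborel. Re (LINT p|lborel. cnj (u (x, p)) * Theta V u (x, p))) = 0"
    by (rule integral_eq_zero_AE)
  also have "(LINT x|lborel. Re (LINT p|lborel. cnj (u (x, p)) * Theta V u (x, p)))
      = Re (LINT x|lborel. LINT p|lborel. cnj (u (x, p)) * Theta V u (x, p))"
    by (rule integral_Re[OF lborel_pair.integrable_fst'[OF T']])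
  finally show ?thesis using lborel_pair.integral_fst'[OF T'] by (simp add: lborel_prod)
qed

section \<open>Transport\<close>

text \<open>
  Integrating \<open>g\<close> along the segment from \<open>x\<close> to \<open>x + v\<close> gives \<open>f (x + v) - f x\<close>. Integrate over
  \<open>x\<close>: by translation invariance the left side becomes the integral of \<open>g\<close> and the right side
  vanishes.
\<close>

lemma integral_directional_derivative:
  fixes f g :: "'a::euclidean_space \<Rightarrow> 'b::euclidean_space"
  assumes f: "integrable lborel f" and g: "integrable lborel g"
    and deriv: "\<And>x. ((\<lambda>s. f (x + s *\<^sub>R v)) has_vector_derivative g x) (at 0)"
  shows "integral\<^sup>L lborel g = 0"
proof -
  have [measurable]: "f \<in> borel_measurable borel" "g \<in> borel_measurable borel" using f g by auto
  define h where "h = (\<lambda>(s::real, x). indicator {0..1} s *\<^sub>R g (x + s *\<^sub>R v))"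
  have shift: "integrable lborel (\<lambda>x. k (x + w))" "(LINT x|lborel. k (x + w)) = integral\<^sup>L lborel k"
    if "integrable lborel k" for k :: "'a \<Rightarrow> 'c::{banach,second_countable_topology}" and w
    using integral_affine[of 1 k w] that by (auto simp: add.commute)
  have h: "integrable (lborel \<Otimes>\<^sub>M lborel) h"
  proof (rule lborel_pair.Fubini_integrable)
    show "h \<in> borel_measurable (lborel \<Otimes>\<^sub>M lborel)" unfolding h_def by measurable
    show "AE s in lborel. integrable lborel (\<lambda>x. h (s, x))"
      unfolding h_def using shift(1)[OF g] by simp
    have "(LINT x|lborel. norm (h (s, x))) = indicator {0..1} s *\<^sub>R (LINT x|lborel. norm (g x))" for s
      unfolding h_def using shift(2)[OF integrable_norm[OF g], of "s *\<^sub>R v"] by simp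
    then show "integrable lborel (\<lambda>s. LINT x|lborel. norm (h (s, x)))"
      by (simp only:) (intro integrable_scaleR_left integrable_real_indicator; simp)
  qed
  have fibre: "AE x in lborel. (LINT s|lborel. h (s, x)) = f (x + v) - f x"
    using lborel_pair.AE_integrable_snd[of "\<lambda>s x. h (s, x)"] h
  proof (simp, elim eventually_mono)
    fix x assume "integrable lborel (\<lambda>s. h (s, x))"
    then have i: "set_integrable lborel {0..1} (\<lambda>s. g (x + s *\<^sub>R v))"
      unfolding h_def set_integrable_def by simp
    have "((\<lambda>s. f (x + s *\<^sub>R v)) has_vector_derivative g (x + s *\<^sub>R v)) (at s within {0..1})" for s
    proof -
      \<comment> \<open>the derivative at parameter 0 is transported to any point of the line by re-centring it\<close>
      have "((\<lambda>r. r - s) has_vector_derivative 1) (at s)"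
        by (auto intro!: derivative_eq_intros)
      moreover have "((\<lambda>r. f ((x + s *\<^sub>R v) + r *\<^sub>R v)) has_vector_derivative g (x + s *\<^sub>R v)) (at (s - s))"
        using deriv[of "x + s *\<^sub>R v"] by simp
      ultimately have "((\<lambda>r. f ((x + s *\<^sub>R v) + r *\<^sub>R v)) \<circ> (\<lambda>r. r - s) has_vector_derivative 1 *\<^sub>R g (x + s *\<^sub>R v)) (at s)"
        by (rule vector_diff_chain_at)
      moreover have "(\<lambda>r. f ((x + s *\<^sub>R v) + r *\<^sub>R v)) \<circ> (\<lambda>r. r - s) = (\<lambda>r. f (x + r *\<^sub>R v))"
        by (auto simp: algebra_simps)
      ultimately show ?thesis by (auto intro: has_vector_derivative_at_within)
    qed
    then have "((\<lambda>s. g (x + s *\<^sub>R v)) has_integral f (x + 1 *\<^sub>R v) - f (x + 0 *\<^sub>R v)) {0..1}"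
      by (intro fundamental_theorem_of_calculus) auto
    then show "(LINT s|lborel. h (s, x)) = f (x + v) - f x"
      using set_borel_integral_eq_integral(2)[OF i] unfolding h_def set_lebesgue_integral_def
      by (simp add: integral_unique)
  qed
  have "integral\<^sup>L lborel g = (LINT s|lborel. indicator {0..1::real} s *\<^sub>R integral\<^sup>L lborel g)"
    by simp
  also have "\<dots> = (LINT s|lborel. LINT x|lborel. h (s, x))"
    unfolding h_def using shift(2)[OF g] by simp
  also have "\<dots> = (LINT x|lborel. LINT s|lborel. h (s, x))"
    using lborel_pair.Fubini_integral[of "\<lambda>s x. h (s, x)"] h by simp
  also have "\<dots> = (LINT x|lborel. f (x + v) - f x)"
    using fibre h by (intro integral_cong_AE)
      (auto intro!: borel_measurable_integrable lborel_pair.integrable_snd)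
  also have "\<dots> = 0" using shift[OF f] f by simp
  finally show ?thesis .
qed

lemma has_vector_derivative_line:
  fixes f :: "'a::euclidean_space \<Rightarrow> 'b::real_normed_vector"
  assumes "f differentiable (at x)"
  shows "((\<lambda>s. f (x + s *\<^sub>R v)) has_vector_derivative frechet_derivative f (at x) v) (at 0)"
proof -
  let ?D = "frechet_derivative f (at x)"
  have D: "(f has_derivative ?D) (at (x + 0 *\<^sub>R v))" using assms by (simp add: frechet_derivative_works)
  have "((\<lambda>s. x + s *\<^sub>R v) has_derivative (\<lambda>s. s *\<^sub>R v)) (at 0)"
    by (auto intro!: derivative_eq_intros)
  from diff_chain_at[OF this D]
  have "((\<lambda>s. f (x + s *\<^sub>R v)) has_derivative (\<lambda>s. ?D (s *\<^sub>R v))) (at 0)" by (simp add: o_def)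
  moreover have "?D (s *\<^sub>R v) = s *\<^sub>R ?D v" for s
    using D by (simp add: has_derivative_def bounded_linear.linear linear_scale)
  ultimately show ?thesis by (simp add: has_vector_derivative_def)
qed

lemma has_vector_derivative_cmod_power2:
  assumes "(f has_vector_derivative f') (at t within S)"
  shows "((\<lambda>s. (cmod (f s))\<^sup>2) has_vector_derivative 2 * Re (cnj (f t) * f')) (at t within S)"
proof -
  have "((\<lambda>s. f s \<bullet> f s) has_derivative (\<lambda>h. f t \<bullet> (h *\<^sub>R f') + (h *\<^sub>R f') \<bullet> f t)) (at t within S)"
    using assms unfolding has_vector_derivative_def by (intro has_derivative_inner)
  moreover have "f t \<bullet> (h *\<^sub>R f') + (h *\<^sub>R f') \<bullet> f t = h *\<^sub>R (2 * Re (cnj (f t) * f'))" for h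
    by (simp add: inner_complex_def algebra_simps)
  ultimately show ?thesis
    by (simp add: has_vector_derivative_def power2_norm_eq_inner)
qed

lemma integral_transport_fibrewise:
  fixes f g :: "'d::finite phase \<Rightarrow> 'b::euclidean_space"
  assumes f: "integrable lborel f" and g: "integrable lborel g"
    and deriv: "\<And>x p. ((\<lambda>s. f (x + s *\<^sub>R p, p)) has_vector_derivative g (x, p)) (at 0)"
  shows "integral\<^sup>L lborel g = 0"
proof -
  have f': "integrable (lborel \<Otimes>\<^sub>M lborel) (\<lambda>(x, p). f (x, p))"
    and g': "integrable (lborel \<Otimes>\<^sub>M lborel) (\<lambda>(x, p). g (x, p))"
    using f g by (simp_all add: lborel_prod)
  have "AE p in lborel. (LINT x|lborel. g (x, p)) = 0"
    using lborel_pair.AE_integrable_snd[OF f'] lborel_pair.AE_integrable_snd[OF g']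
  proof eventually_elim
    case (elim p)
    then show ?case by (rule integral_directional_derivative[where v=p]) (rule deriv)
  qed
  then have "(LINT p|lborel. LINT x|lborel. g (x, p)) = 0" by (rule integral_eq_zero_AE)
  then show ?thesis using lborel_pair.integral_snd[OF g'] by (simp add: lborel_prod)
qed

lemma integral_transport:
  fixes w :: "'d::finite phase \<Rightarrow> complex"
  assumes w: "integrable lborel w" and t: "integrable lborel (transport w)"
    and d: "\<And>x p. (\<lambda>x'. w (x', p)) differentiable (at x)"
  shows "(LINT z|lborel. transport w z) = 0"
  by (rule integral_transport_fibrewise[OF w t])
    (use has_vector_derivative_line[OF d] in \<open>simp add: transport_def\<close>)

text \<open>
  Twice the integrand has the real part \<open>p \<cdot> \<nabla>\<^sub>x |u|\<^sup>2\<close>, and \<open>|u|\<^sup>2\<close> is integrable.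
\<close>

lemma energy_transport:
  fixes u :: "'d::finite phase \<Rightarrow> complex"
  assumes u: "integrable lborel (\<lambda>z. (cmod (u z))\<^sup>2)"
    and t: "integrable lborel (\<lambda>z. cnj (u z) * transport u z)"
    and d: "\<And>x p. (\<lambda>x'. u (x', p)) differentiable (at x)"
  shows "Re (LINT z|lborel. cnj (u z) * transport u z) = 0"
proof -
  have "(LINT z|lborel. 2 * Re (cnj (u z) * transport u z)) = 0"
  proof (rule integral_transport_fibrewise[OF u])
    show "integrable lborel (\<lambda>z. 2 * Re (cnj (u z) * transport u z))"
      by (intro integrable_mult_right integrable_Re t)
    fix x p
    have "((\<lambda>s. u (x + s *\<^sub>R p, p)) has_vector_derivative transport u (x, p)) (at 0)"
      using has_vector_derivative_line[OF d] by (simp add: transport_def)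
    from has_vector_derivative_cmod_power2[OF this]
    show "((\<lambda>s. (cmod (u (x + s *\<^sub>R p, p)))\<^sup>2) has_vector_derivative 2 * Re (cnj (u (x, p)) * transport u (x, p))) (at 0)"
      by simp
  qed
  then show ?thesis by (simp only: integral_mult_right_zero integral_Re[OF t])
qed

section \<open>Mass and energy balance\<close>

text \<open>
  On every fibre the fundamental theorem of calculus holds with the gauge integral. On almost every
  fibre the derivative is Lebesgue integrable, so there both integrals agree and Fubini's theorem
  can be used to integrate over \<open>z\<close>.
\<close>

lemma has_integral_phase_increment:
  fixes f f' :: "real \<Rightarrow> 'a::euclidean_space \<Rightarrow> 'b::euclidean_space"
  assumes T: "0 \<le> T"
    and deriv: "\<And>t z. t \<in> {0..T} \<Longrightarrow> ((\<lambda>s. f s z) has_vector_derivative f' t z) (at t within {0..T})"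
    and f: "integrable lborel (f 0)" "integrable lborel (f T)"
    and f': "set_integrable lborel ({0..T} \<times> UNIV) (\<lambda>(t, z). f' t z)"
  shows "((\<lambda>t. LINT z|lborel. f' t z) has_integral (LINT z|lborel. f T z) - (LINT z|lborel. f 0 z)) {0..T}"
proof -
  define h where "h = (\<lambda>t z. indicator {0..T} t *\<^sub>R f' t z)"
  have h: "integrable (lborel \<Otimes>\<^sub>M lborel) (case_prod h)"
  proof -
    have "(\<lambda>y::real \<times> 'a. indicator ({0..T} \<times> UNIV) y *\<^sub>R (case y of (t, z) \<Rightarrow> f' t z)) = case_prod h"
      by (auto simp: h_def indicator_def)
    then show ?thesis using f' by (simp add: set_integrable_def lborel_prod)
  qed
  have fibre: "AE z in lborel. (LINT t|lborel. h t z) = f T z - f 0 z"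
    using lborel_pair.AE_integrable_snd[OF h]
  proof eventually_elim
    case (elim z)
    then have i: "set_integrable lborel {0..T} (\<lambda>t. f' t z)" unfolding set_integrable_def h_def .
    have "((\<lambda>t. f' t z) has_integral f T z - f 0 z) {0..T}"
      by (rule fundamental_theorem_of_calculus[OF T deriv])
    then show ?case using set_borel_integral_eq_integral(2)[OF i]
      by (simp add: h_def set_lebesgue_integral_def integral_unique)
  qed
  have "(LINT t|lborel. LINT z|lborel. h t z) = (LINT z|lborel. LINT t|lborel. h t z)"
    using lborel_pair.Fubini_integral[OF h] by simp
  also have "\<dots> = (LINT z|lborel. f T z - f 0 z)"
    using fibre lborel_pair.integrable_snd[OF h] f by (intro integral_cong_AE) auto
  also have "\<dots> = (LINT z|lborel. f T z) - (LINT z|lborel. f 0 z)" using f by simp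
  finally have eq: "(LINT t|lborel. LINT z|lborel. h t z) = (LINT z|lborel. f T z) - (LINT z|lborel. f 0 z)" .
  have hz: "(LINT z|lborel. h t z) = indicator {0..T} t *\<^sub>R (LINT z|lborel. f' t z)" for t
    by (simp add: h_def)
  have i: "set_integrable lborel {0..T} (\<lambda>t. LINT z|lborel. f' t z)"
    using lborel_pair.integrable_fst[OF h] unfolding hz set_integrable_def .
  show ?thesis
    using set_borel_integral_eq_integral[OF i] eq unfolding hz set_lebesgue_integral_def
    by (simp add: has_integral_iff)
qed

lemma slab_integrable_AE:
  assumes "slab_integrable f"
  shows "AE t in lborel. 0 \<le> t \<longrightarrow> integrable lborel (f t)"
proof -
  have "AE t in lborel. \<forall>n::nat. t \<in> {0..real n} \<longrightarrow> integrable lborel (f t)"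
    unfolding AE_all_countable
  proof
    fix n :: nat
    have "(\<lambda>y. indicator ({0..real n} \<times> UNIV) y *\<^sub>R (case y of (t, z) \<Rightarrow> f t z))
        = (\<lambda>(t, z). indicator {0..real n} t *\<^sub>R f t z)"
      by (auto simp: indicator_def)
    then have "integrable (lborel \<Otimes>\<^sub>M lborel) (\<lambda>(t, z). indicator {0..real n} t *\<^sub>R f t z)"
      using assms by (auto simp: slab_integrable_def set_integrable_def lborel_prod dest: spec[of _ "real n"])
    from lborel_pair.AE_integrable_fst[OF this]
    show "AE t in lborel. t \<in> {0..real n} \<longrightarrow> integrable lborel (f t)"
      by eventually_elim auto
  qed
  then show ?thesis
    by eventually_elim (metis atLeastAtMost_iff real_arch_simple)
qed

text \<open>
  Transfers identities known for almost every time, which is all that Fubini provides, to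
  integral equations in time.
\<close>

lemma has_integral_AE_cong:
  fixes f g :: "'a::euclidean_space \<Rightarrow> 'b::euclidean_space"
  assumes "(f has_integral I) S" and "AE x in lborel. x \<in> S \<longrightarrow> g x = f x"
  shows "(g has_integral I) S"
proof -
  from assms(2) obtain N where N: "N \<in> null_sets lborel" "{x \<in> space lborel. \<not> (x \<in> S \<longrightarrow> g x = f x)} \<subseteq> N"
    unfolding eventually_ae_filter by auto
  have "negligible N" using N(1) by (simp add: negligible_iff_null_sets null_sets_completionI)
  then show ?thesis by (rule has_integral_spike[OF _ _ assms(1)]) (use N(2) in auto)
qed

lemma at_within_nonneg_not_bot: "0 \<le> t \<Longrightarrow> at t within {0..} \<noteq> (bot :: real filter)"
proof -
  assume t: "0 \<le> t"
  have "{0..} \<noteq> {x}" for x :: real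
  proof
    assume "{0..} = {x}"
    moreover have "0 \<in> {0::real..}" "1 \<in> {0::real..}" by auto
    ultimately show False by auto
  qed
  then show ?thesis using connected_imp_perfect[of "{0::real..}" t] t
    by (auto simp: trivial_limit_within)
qed

lemma has_vector_derivative_time_deriv:
  assumes "(\<lambda>s. w s z) differentiable (at t within {0..})"
  shows "((\<lambda>s. w s z) has_vector_derivative time_deriv w t z) (at t within {0..})"
  using assms by (simp add: time_deriv_def vector_derivative_works)

lemma admissibleD:
  assumes "admissible V w" and "0 \<le> t"
  shows "(\<lambda>s. w s z) differentiable (at t within {0..})"
    and "(\<lambda>x'. w t (x', p)) differentiable (at x)"
    and "Theta_converges V (w t)"
    and "integrable lborel (w t)"
  using assms unfolding admissible_def by blast+

text \<open>
  At almost every time all three terms on the left are integrable over phase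
  space, and the integrals of the transport and potential terms vanish.
\<close>

lemma mass_balance:
  fixes V :: "real ^ 'd::finite \<Rightarrow> real"
  assumes V: "V \<in> borel_measurable borel" and adm: "admissible V w" and T: "0 \<le> T"
    and eqn: "\<And>t z. 0 \<le> t \<Longrightarrow> time_deriv w t z + transport (w t) z + Theta V (w t) z = R t z"
  shows "((\<lambda>t. LINT z|lborel. R t z) has_integral phase_integral (w T) - phase_integral (w 0)) {0..T}"
proof -
  have A: "((\<lambda>t. LINT z|lborel. time_deriv w t z) has_integral phase_integral (w T) - phase_integral (w 0)) {0..T}"
    unfolding phase_integral_def
  proof (rule has_integral_phase_increment[OF T])
    show "((\<lambda>s. w s z) has_vector_derivative time_deriv w t z) (at t within {0..T})" if "t \<in> {0..T}" for t z
    proof (rule has_vector_derivative_within_subset[of _ _ _ "{0..}"])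
      have "(\<lambda>s. w s z) differentiable (at t within {0..})"
        using that by (intro admissibleD(1)[OF adm]) simp
      then show "((\<lambda>s. w s z) has_vector_derivative time_deriv w t z) (at t within {0..})"
        by (rule has_vector_derivative_time_deriv)
    qed auto
  qed (use adm T in \<open>auto simp: admissible_def slab_integrable_def\<close>)
  have slabs: "slab_integrable (time_deriv w)" "slab_integrable (\<lambda>t. transport (w t))" "slab_integrable (\<lambda>t. Theta V (w t))"
    using adm by (auto simp: admissible_def)
  have "AE t in lborel. t \<in> {0..T} \<longrightarrow> (LINT z|lborel. R t z) = (LINT z|lborel. time_deriv w t z)"
    using slabs[THEN slab_integrable_AE]
  proof eventually_elim
    case (elim t)
    show ?case
    proof
      assume "t \<in> {0..T}"
      then have t: "0 \<le> t" by simp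
      then have i: "integrable lborel (time_deriv w t)" "integrable lborel (transport (w t))" "integrable lborel (Theta V (w t))"
        using elim by auto
      have "(LINT z|lborel. transport (w t) z) = 0" "(LINT z|lborel. Theta V (w t) z) = 0"
        using adm t i by (auto simp: admissible_def intro!: integral_transport integral_Theta V)
      then show "(LINT z|lborel. R t z) = (LINT z|lborel. time_deriv w t z)"
        using i unfolding eqn[OF t, symmetric] by simp
    qed
  qed
  then show ?thesis by (rule has_integral_AE_cong[OF A])
qed

text \<open>
  Multiply the equation by the conjugate of \<open>u\<close> and take real parts: at almost every time the
  transport and potential terms integrate to purely imaginary numbers.
\<close>

lemma energy_balance:
  fixes V :: "real ^ 'd::finite \<Rightarrow> real"
  assumes adm: "energy_admissible V u" and T: "0 \<le> T"
    and dt: "\<And>t z. 0 \<le> t \<Longrightarrow> (\<lambda>s. u s z) differentiable (at t within {0..})"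
    and dx: "\<And>t x p. 0 \<le> t \<Longrightarrow> (\<lambda>x'. u t (x', p)) differentiable (at x)"
    and int: "\<And>t. 0 \<le> t \<Longrightarrow> integrable lborel (u t)"
    and conv: "\<And>t. 0 \<le> t \<Longrightarrow> Theta_converges V (u t)"
    and eqn: "\<And>t z. 0 \<le> t \<Longrightarrow> time_deriv u t z + transport (u t) z + Theta V (u t) z = c t *\<^sub>R u t z"
  shows "((\<lambda>t. 2 * c t * (LINT z|lborel. (cmod (u t z))\<^sup>2)) has_integral
     (LINT z|lborel. (cmod (u T z))\<^sup>2) - (LINT z|lborel. (cmod (u 0 z))\<^sup>2)) {0..T}"
proof -
  define g where "g = (\<lambda>t z. 2 * Re (cnj (u t z) * time_deriv u t z))"
  have sq: "integrable lborel (\<lambda>z. (cmod (u t z))\<^sup>2)" if "0 \<le> t" for t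
    using adm that by (simp add: energy_admissible_def)
  have A: "((\<lambda>t. LINT z|lborel. g t z) has_integral
     (LINT z|lborel. (cmod (u T z))\<^sup>2) - (LINT z|lborel. (cmod (u 0 z))\<^sup>2)) {0..T}"
  proof (rule has_integral_phase_increment[OF T])
    show "((\<lambda>s. (cmod (u s z))\<^sup>2) has_vector_derivative g t z) (at t within {0..T})" if "t \<in> {0..T}" for t z
      unfolding g_def
    proof (rule has_vector_derivative_within_subset[of _ _ _ "{0..}"])
      have "(\<lambda>s. u s z) differentiable (at t within {0..})"
        using dt that unfolding atLeastAtMost_iff by blast
      then show "((\<lambda>s. (cmod (u s z))\<^sup>2) has_vector_derivative 2 * Re (cnj (u t z) * time_deriv u t z)) (at t within {0..})"
        by (intro has_vector_derivative_cmod_power2 has_vector_derivative_time_deriv)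
    qed auto
    have "set_integrable lborel ({0..T} \<times> UNIV) (\<lambda>(t, z). cnj (u t z) * time_deriv u t z)"
      using adm T by (auto simp: energy_admissible_def slab_integrable_def)
    then have "integrable lborel (\<lambda>y. 2 * Re (indicator ({0..T} \<times> UNIV) y *\<^sub>R (case y of (t, z) \<Rightarrow> cnj (u t z) * time_deriv u t z)))"
      unfolding set_integrable_def by (intro integrable_mult_right integrable_Re)
    moreover have "(\<lambda>y. 2 * Re (indicator ({0..T} \<times> UNIV) y *\<^sub>R (case y of (t, z) \<Rightarrow> cnj (u t z) * time_deriv u t z)))
      = (\<lambda>y. indicator ({0..T} \<times> UNIV) y *\<^sub>R (case y of (t, z) \<Rightarrow> g t z))"
      by (auto simp: g_def indicator_def)
    ultimately show "set_integrable lborel ({0..T} \<times> UNIV) (\<lambda>(t, z). g t z)"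
      unfolding set_integrable_def by (simp only:)
  qed (use sq T in auto)
  have slabs: "slab_integrable (\<lambda>t z. cnj (u t z) * time_deriv u t z)"
    "slab_integrable (\<lambda>t z. cnj (u t z) * transport (u t) z)" "slab_integrable (\<lambda>t z. cnj (u t z) * Theta V (u t) z)"
    using adm by (auto simp: energy_admissible_def)
  have "AE t in lborel. t \<in> {0..T} \<longrightarrow> 2 * c t * (LINT z|lborel. (cmod (u t z))\<^sup>2) = (LINT z|lborel. g t z)"
    using slabs[THEN slab_integrable_AE]
  proof eventually_elim
    case (elim t)
    show ?case
    proof
      assume "t \<in> {0..T}"
      then have t: "0 \<le> t" by simp
      then have i: "integrable lborel (\<lambda>z. cnj (u t z) * time_deriv u t z)"
          "integrable lborel (\<lambda>z. cnj (u t z) * transport (u t) z)"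
          "integrable lborel (\<lambda>z. cnj (u t z) * Theta V (u t) z)"
        using elim by auto
      have z: "Re (LINT z|lborel. cnj (u t z) * transport (u t) z) = 0"
          "Re (LINT z|lborel. cnj (u t z) * Theta V (u t) z) = 0"
        using energy_transport[OF sq[OF t] i(2) dx[OF t]] energy_Theta[OF conv[OF t] int[OF t] i(3)] by auto
      have e: "complex_of_real (c t * (cmod (u t z))\<^sup>2) = cnj (u t z) * time_deriv u t z
          + cnj (u t z) * transport (u t) z + cnj (u t z) * Theta V (u t) z" for z
      proof -
        have "cnj (u t z) * time_deriv u t z + cnj (u t z) * transport (u t) z + cnj (u t z) * Theta V (u t) z
           = cnj (u t z) * (c t *\<^sub>R u t z)"
          unfolding eqn[OF t, symmetric] by (simp add: algebra_simps)
        then show ?thesis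
          by (simp only: of_real_mult complex_norm_square scaleR_conv_of_real mult_ac)
      qed
      have "complex_of_real (c t * (LINT z|lborel. (cmod (u t z))\<^sup>2)) = (LINT z|lborel. complex_of_real (c t * (cmod (u t z))\<^sup>2))"
        unfolding integral_complex_of_real by simp
      also have "\<dots> = (LINT z|lborel. cnj (u t z) * time_deriv u t z)
          + (LINT z|lborel. cnj (u t z) * transport (u t) z) + (LINT z|lborel. cnj (u t z) * Theta V (u t) z)"
        unfolding e using i by simp
      finally have "Re (complex_of_real (c t * (LINT z|lborel. (cmod (u t z))\<^sup>2))) = Re (LINT z|lborel. cnj (u t z) * time_deriv u t z)"
        using z by (simp only: plus_complex.sel)
      then have "c t * (LINT z|lborel. (cmod (u t z))\<^sup>2) = Re (LINT z|lborel. cnj (u t z) * time_deriv u t z)"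
        by (simp only: Re_complex_of_real)
      then show "2 * c t * (LINT z|lborel. (cmod (u t z))\<^sup>2) = (LINT z|lborel. g t z)"
        unfolding g_def integral_mult_right_zero integral_Re[OF i(1)] by (simp only: mult.assoc)
    qed
  qed
  then show ?thesis by (rule has_integral_AE_cong[OF A])
qed

lemma time_deriv_diff:
  assumes "(\<lambda>s. f s z) differentiable (at t within {0..})" "(\<lambda>s. g s z) differentiable (at t within {0..})" "0 \<le> t"
  shows "time_deriv (\<lambda>t z. f t z - g t z) t z = time_deriv f t z - time_deriv g t z"
proof -
  have "((\<lambda>s. f s z - g s z) has_vector_derivative time_deriv f t z - time_deriv g t z) (at t within {0..})"
    using assms by (intro has_vector_derivative_diff has_vector_derivative_time_deriv)
  then show ?thesis unfolding time_deriv_def[of "\<lambda>t z. f t z - g t z"]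
    by (rule vector_derivative_within[OF at_within_nonneg_not_bot[OF assms(3)]])
qed

lemma transport_diff:
  assumes "\<And>x p. (\<lambda>x'. f (x', p)) differentiable (at x)" "\<And>x p. (\<lambda>x'. g (x', p)) differentiable (at x)"
  shows "transport (\<lambda>z. f z - g z) z = transport f z - transport g z"
proof (cases z)
  case (Pair x p)
  let ?D = "\<lambda>h. frechet_derivative (\<lambda>x'. h (x', p)) (at x)"
  have "((\<lambda>x'. f (x', p) - g (x', p)) has_derivative (\<lambda>v. ?D f v - ?D g v)) (at x)"
    using assms by (intro has_derivative_diff) (simp_all add: frechet_derivative_works[symmetric])
  from frechet_derivative_at[OF this, symmetric] show ?thesis unfolding Pair transport_def by simp
qed

lemma Theta_diff:
  assumes f: "Theta_converges V f" and g: "Theta_converges V g"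
  shows "Theta_converges V (\<lambda>z. f z - g z)" "Theta V (\<lambda>z. f z - g z) z = Theta V f z - Theta V g z"
proof -
  have e: "Theta_integrand V (\<lambda>z. f z - g z) x p y p' = Theta_integrand V f x p y p' - Theta_integrand V g x p y p'" for x p y p'
    by (simp add: Theta_integrand_def algebra_simps)
  have i: "integrable lborel (Theta_integrand V f x p y)" "integrable lborel (Theta_integrand V g x p y)"
     "integrable lborel (\<lambda>y. LINT p'|lborel. Theta_integrand V f x p y p')"
     "integrable lborel (\<lambda>y. LINT p'|lborel. Theta_integrand V g x p y p')" for x p y
    using f g by (auto simp: Theta_converges_def)
  have e': "Theta_integrand V (\<lambda>z. f z - g z) x p y = (\<lambda>p'. Theta_integrand V f x p y p' - Theta_integrand V g x p y p')" for x p y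
    using e by auto
  have l: "(LINT p'|lborel. Theta_integrand V (\<lambda>z. f z - g z) x p y p')
     = (LINT p'|lborel. Theta_integrand V f x p y p') - (LINT p'|lborel. Theta_integrand V g x p y p')" for x p y
    unfolding e using i by simp
  show "Theta_converges V (\<lambda>z. f z - g z)"
    unfolding Theta_converges_def l unfolding e' using i by simp
  show "Theta V (\<lambda>z. f z - g z) z = Theta V f z - Theta V g z"
    unfolding Theta_def l using i by (simp add: case_prod_beta algebra_simps)
qed

section \<open>Ordinary differential equations\<close>

text \<open>
  First half of the bootstrap from an integral equation to a differential one. When \<open>k\<close> is a
  continuous expression in such functions \<open>f\<close>, it follows that \<open>k\<close> is continuous, and then
  \<open>f\<close> is differentiable.
\<close>

lemma integral_equation_continuous:
  fixes f k :: "real \<Rightarrow> 'b::euclidean_space"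
  assumes k: "\<And>t. 0 \<le> t \<Longrightarrow> t \<le> T \<Longrightarrow> (k has_integral f t - f 0) {0..t}" and T: "0 \<le> T"
  shows "continuous_on {0..T} f"
proof -
  have "k integrable_on {0..T}" using k[of T] T by (auto simp: integrable_on_def)
  then have "continuous_on {0..T} (\<lambda>t. f 0 + integral {0..t} k)"
    by (intro continuous_intros indefinite_integral_continuous_1)
  moreover have "f 0 + integral {0..t} k = f t" if "t \<in> {0..T}" for t
    using integral_unique[OF k[of t]] that by simp
  ultimately show ?thesis by (rule continuous_on_eq)
qed

lemma integral_equation_derivative:
  fixes f k :: "real \<Rightarrow> 'b::euclidean_space"
  assumes k: "\<And>t. 0 \<le> t \<Longrightarrow> t \<le> T \<Longrightarrow> (k has_integral f t - f 0) {0..t}"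
    and c: "continuous_on {0..T} k" and t: "t \<in> {0..T}"
  shows "(f has_vector_derivative k t) (at t within {0..T})"
proof -
  have "((\<lambda>t. f 0 + integral {0..t} k) has_vector_derivative 0 + k t) (at t within {0..T})"
    by (intro has_vector_derivative_add has_vector_derivative_const integral_has_vector_derivative c t)
  moreover have "f 0 + integral {0..s} k = f s" if "s \<in> {0..T}" for s
    using integral_unique[OF k[of s]] that by simp
  ultimately show ?thesis using t by (subst (asm) has_vector_derivative_cong_ev[of _ _ f]) (auto intro!: always_eventually simp: eventually_at_filter)
qed

text \<open>
  Multiplication by the integrating factor \<open>exp (- \<integral> a)\<close> makes \<open>f\<close> constant.
\<close>

lemma linear_ode_zero:
  fixes f a :: "real \<Rightarrow> complex"
  assumes d: "\<And>t. t \<in> {0..T} \<Longrightarrow> (f has_vector_derivative a t * f t) (at t within {0..T})"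
    and a: "continuous_on {0..T} a" and f0: "f 0 = 0" and t: "t \<in> {0..T}"
  shows "f t = 0"
proof -
  define P where "P = (\<lambda>t. - integral {0..t} a)"
  have "((\<lambda>t. f t * exp (P t)) has_vector_derivative 0) (at s within {0..T})" if s: "s \<in> {0..T}" for s
  proof -
    have "(P has_vector_derivative - a s) (at s within {0..T})"
      unfolding P_def by (intro has_vector_derivative_minus integral_has_vector_derivative a s)
    then have "((exp \<circ> P) has_vector_derivative - a s * exp (P s)) (at s within {0..T})"
      by (rule field_vector_diff_chain_within) (rule DERIV_subset[OF DERIV_exp subset_UNIV])
    from has_vector_derivative_mult[OF d[OF s] this]
    show ?thesis by (simp add: algebra_simps o_def)
  qed
  then obtain c where c: "\<And>s. s \<in> {0..T} \<Longrightarrow> f s * exp (P s) = c"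
    by (rule has_vector_derivative_zero_constant[rotated]) auto
  have "f t * exp (P t) = f 0 * exp (P 0)" using c t by auto
  then show ?thesis using f0 by simp
qed

text \<open>
  The cross term of the square is nonnegative by assumption.
\<close>

lemma order_parameter_lower_bound:
  fixes a b :: complex and s :: real
  assumes "0 \<le> Re (a * cnj b)"
  shows "(cmod a)\<^sup>2 * (exp s)\<^sup>2 \<le> (cmod (exp s *\<^sub>R a + exp (- s) *\<^sub>R b))\<^sup>2"
proof -
  have "(cmod (exp s *\<^sub>R a + exp (- s) *\<^sub>R b))\<^sup>2
      = (exp s)\<^sup>2 * (cmod a)\<^sup>2 + (exp (- s))\<^sup>2 * (cmod b)\<^sup>2 + 2 * (exp s * exp (- s)) * Re (a * cnj b)"
    unfolding cmod_power2 by (simp add: power2_eq_square algebra_simps)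
  moreover have "0 \<le> 2 * (exp s * exp (- s)) * Re (a * cnj b)"
    using assms by (intro mult_nonneg_nonneg) auto
  ultimately show ?thesis by (simp add: mult.commute)
qed

text \<open>
  The Riccati equation for \<open>z\<close> is the projective form of the linear system \<open>D' = K/2 E\<close>,
  \<open>E' = K/2 D\<close>. The relation is used as \<open>z D = E\<close> rather than \<open>z = E / D\<close>, because \<open>z D - E\<close> solves
  a homogeneous linear equation whether or not \<open>D\<close> has zeros. It makes \<open>N |D|\<^sup>2\<close> constant, and the
  bound on \<open>z 0\<close> bounds \<open>|D|\<^sup>2\<close> from below by \<open>e\<^sup>K\<^sup>t |1 + z 0|\<^sup>2\<close>.
\<close>

lemma decay_of_order_parameter_system:
  fixes z :: "real \<Rightarrow> complex" and N :: "real \<Rightarrow> real"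
  assumes T: "0 \<le> T"
    and z: "\<And>t. t \<in> {0..T} \<Longrightarrow> (z has_vector_derivative (K / 2) *\<^sub>R (1 - z t * z t)) (at t within {0..T})"
    and N: "\<And>t. t \<in> {0..T} \<Longrightarrow> (N has_vector_derivative - K * Re (z t) * N t) (at t within {0..T})"
    and z0: "cmod (z 0) \<le> 1" and N0: "0 \<le> N T"
  shows "N T * (cmod (1 + z 0))\<^sup>2 \<le> 4 * N 0 * exp (- K * T)"
proof -
  define e where "e = (\<lambda>t::real. exp (K * t / 2))"
  define e' where "e' = (\<lambda>t::real. exp (- (K * t / 2)))"
  define D where "D = (\<lambda>t. e t *\<^sub>R (1 + z 0) + e' t *\<^sub>R (1 - z 0))"
  define E where "E = (\<lambda>t. e t *\<^sub>R (1 + z 0) - e' t *\<^sub>R (1 - z 0))"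
  have "(e has_real_derivative (K / 2) * e t) (at t within S)" "(e' has_real_derivative - (K / 2) * e' t) (at t within S)" for t S
    unfolding e_def e'_def by (auto intro!: derivative_eq_intros)
  then have de: "(e has_vector_derivative (K / 2) * e t) (at t within S)" "(e' has_vector_derivative - (K / 2) * e' t) (at t within S)" for t S
    by (simp_all add: has_real_derivative_iff_has_vector_derivative)
  have dsc: "((\<lambda>t. e t *\<^sub>R a) has_vector_derivative ((K / 2) * e t) *\<^sub>R a) (at t within S)"
    "((\<lambda>t. e' t *\<^sub>R a) has_vector_derivative (- (K / 2) * e' t) *\<^sub>R a) (at t within S)" for a :: complex and t S
    by (rule bounded_linear.has_vector_derivative[OF bounded_linear_scaleR_left de(1)],
        rule bounded_linear.has_vector_derivative[OF bounded_linear_scaleR_left de(2)])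
  have dD: "(D has_vector_derivative (K / 2) *\<^sub>R E t) (at t within S)" for t S
  proof -
    have eq: "((K / 2) * e t) *\<^sub>R a + (- (K / 2) * e' t) *\<^sub>R b = (K / 2) *\<^sub>R (e t *\<^sub>R a - e' t *\<^sub>R b)" for a b :: complex
      by (simp add: scaleR_diff_right)
    show ?thesis unfolding D_def E_def eq[symmetric] by (intro has_vector_derivative_add dsc)
  qed
  have dE: "(E has_vector_derivative (K / 2) *\<^sub>R D t) (at t within S)" for t S
  proof -
    have eq: "((K / 2) * e t) *\<^sub>R a - (- (K / 2) * e' t) *\<^sub>R b = (K / 2) *\<^sub>R (e t *\<^sub>R a + e' t *\<^sub>R b)" for a b :: complex
      by (simp add: scaleR_add_right)
    show ?thesis unfolding D_def E_def eq[symmetric] by (intro has_vector_derivative_diff dsc)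
  qed
  have zc: "continuous_on {0..T} z"
    using z by (meson continuous_on_eq_continuous_within has_vector_derivative_continuous)
  have zD: "z t * D t = E t" if t: "t \<in> {0..T}" for t
  proof -
    have "z t * D t - E t = 0"
    proof (rule linear_ode_zero[OF _ _ _ t])
      show "((\<lambda>t. z t * D t - E t) has_vector_derivative (- (K / 2) *\<^sub>R z s) * (z s * D s - E s)) (at s within {0..T})"
        if "s \<in> {0..T}" for s
        using has_vector_derivative_diff[OF has_vector_derivative_mult[OF z[OF that] dD[of s "{0..T}"]] dE[of s "{0..T}"]]
        by (rule has_vector_derivative_eq_rhs) (simp add: scaleR_conv_of_real field_simps)
      show "continuous_on {0..T} (\<lambda>s. - (K / 2) *\<^sub>R z s)" by (intro continuous_intros zc)
      show "z 0 * D 0 - E 0 = 0" by (simp add: D_def E_def e_def e'_def algebra_simps)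
    qed
    then show ?thesis by simp
  qed
  have "((\<lambda>t. N t * (cmod (D t))\<^sup>2) has_vector_derivative 0) (at t within {0..T})" if t: "t \<in> {0..T}" for t
  proof -
    have "2 * Re (cnj (D t) * ((K / 2) *\<^sub>R E t)) = K * Re (z t) * (cmod (D t))\<^sup>2"
    proof -
      have "cnj (D t) * ((K / 2) *\<^sub>R E t) = (K / 2) *\<^sub>R (z t * complex_of_real ((cmod (D t))\<^sup>2))"
        unfolding zD[OF t, symmetric] complex_norm_square by (simp add: mult_ac)
      moreover have "Re ((K / 2) *\<^sub>R (v * complex_of_real r)) = K / 2 * (Re v * r)" for v r by simp
      ultimately have "Re (cnj (D t) * ((K / 2) *\<^sub>R E t)) = K / 2 * (Re (z t) * (cmod (D t))\<^sup>2)" by (simp only:)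
      then show ?thesis by linarith
    qed
    with has_vector_derivative_cmod_power2[OF dD[of t "{0..T}"]]
    have "((\<lambda>t. (cmod (D t))\<^sup>2) has_vector_derivative K * Re (z t) * (cmod (D t))\<^sup>2) (at t within {0..T})" by (simp only:)
    from has_vector_derivative_mult[OF N[OF t] this] show ?thesis by (simp add: algebra_simps)
  qed
  then obtain c where c: "\<And>t. t \<in> {0..T} \<Longrightarrow> N t * (cmod (D t))\<^sup>2 = c"
    by (rule has_vector_derivative_zero_constant[rotated]) auto
  have "D 0 = 2" by (simp add: D_def e_def e'_def)
  then have cons: "N T * (cmod (D T))\<^sup>2 = 4 * N 0" using c[of T] c[of 0] T by simp
  have "(cmod (z 0))\<^sup>2 \<le> 1" using z0 by (simp add: power_le_one)
  \<comment> \<open>this real part equals 1 - |z 0|^2\<close>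
  then have "0 \<le> Re ((1 + z 0) * cnj (1 - z 0))"
    by (simp add: cmod_power2) (simp add: power2_eq_square algebra_simps)
  from order_parameter_lower_bound[OF this, of "K * T / 2"]
  have "(cmod (1 + z 0))\<^sup>2 * exp (K * T) \<le> (cmod (D T))\<^sup>2"
    by (simp add: D_def e_def e'_def flip: exp_double)
  from mult_left_mono[OF this N0]
  have "N T * ((cmod (1 + z 0))\<^sup>2 * exp (K * T)) \<le> 4 * N 0" unfolding cons .
  then show ?thesis by (simp add: exp_minus field_simps)
qed

section \<open>Decay of the difference of the two densities\<close>

text \<open>
  The order in which the balance laws are used matters: continuity of \<open>z\<close> comes from its integral
  equation alone, then the masses are seen to be constant, and only then does the equation for \<open>z\<close> close.
\<close>

lemma wigner_lohe_decay:
  fixes V :: "real ^ 'd::finite \<Rightarrow> real"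
  assumes V: "V \<in> borel_measurable borel" and sol: "wigner_lohe_solution K V w1 w2 w12"
    and m: "phase_integral (w1 0) = 1" "phase_integral (w2 0) = 1" and z0: "cmod (phase_integral (w12 0)) \<le> 1"
    and T: "0 \<le> T"
  shows "(L2_norm_phase (\<lambda>z. w1 T z - w2 T z))\<^sup>2 * (cmod (1 + phase_integral (w12 0)))\<^sup>2
    \<le> 4 * (L2_norm_phase (\<lambda>z. w1 0 z - w2 0 z))\<^sup>2 * exp (- K * T)"
proof -
  define z where "z = (\<lambda>t. phase_integral (w12 t))"
  have adm: "admissible V w1" "admissible V w2" "admissible V w12"
    and en: "energy_admissible V (\<lambda>t z. w1 t z - w2 t z)"
    using sol by (auto simp: wigner_lohe_solution_def)
  have eq1: "time_deriv w1 t y + transport (w1 t) y + Theta V (w1 t) y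
        = (K / 2) *\<^sub>R (complex_of_real (Re (w12 t y)) - Re (z t) *\<^sub>R w1 t y)"
    and eq2: "time_deriv w2 t y + transport (w2 t) y + Theta V (w2 t) y
        = (K / 2) *\<^sub>R (complex_of_real (Re (w12 t y)) - Re (z t) *\<^sub>R w2 t y)"
    and eq12: "time_deriv w12 t y + transport (w12 t) y + Theta V (w12 t) y
        = (K / 4) *\<^sub>R (w1 t y + w2 t y - 2 * z t * w12 t y)" if "0 \<le> t" for t y
    using sol that unfolding wigner_lohe_solution_def Let_def z_def by blast+
  have int: "integrable lborel (w1 t)" "integrable lborel (w2 t)" "integrable lborel (w12 t)" if "0 \<le> t" for t
    using adm that by (auto simp: admissible_def)
  have R: "(LINT y|lborel. (K / 2) *\<^sub>R (complex_of_real (Re (w12 t y)) - Re (z t) *\<^sub>R w t y))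
      = (K / 2) *\<^sub>R (complex_of_real (Re (z t)) - Re (z t) *\<^sub>R phase_integral (w t))"
    if "0 \<le> t" "integrable lborel (w t)" for t w
  proof -
    have "integrable lborel (\<lambda>y. complex_of_real (Re (w12 t y)))"
      using int(3)[OF that(1)] by (intro integrable_of_real integrable_Re)
    moreover have "(LINT y|lborel. complex_of_real (Re (w12 t y))) = complex_of_real (Re (z t))"
      using int(3)[OF that(1)] unfolding integral_complex_of_real by (simp add: z_def phase_integral_def)
    ultimately show ?thesis using that(2) by (simp add: phase_integral_def)
  qed
  have R12: "(LINT y|lborel. (K / 4) *\<^sub>R (w1 t y + w2 t y - 2 * z t * w12 t y))
      = (K / 4) *\<^sub>R (phase_integral (w1 t) + phase_integral (w2 t) - 2 * z t * z t)" if "0 \<le> t" for t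
    using int[OF that] by (simp add: z_def phase_integral_def)
  have hz: "((\<lambda>t. LINT y|lborel. (K / 4) *\<^sub>R (w1 t y + w2 t y - 2 * z t * w12 t y)) has_integral z t - z 0) {0..t}"
    if "0 \<le> t" for t
    using mass_balance[OF V adm(3) that eq12] unfolding z_def by simp
  have zc: "continuous_on {0..T} z"
    by (rule integral_equation_continuous[OF hz T])
  have mass1: "phase_integral (w t) = 1"
    if adm: "admissible V w" and w0: "phase_integral (w 0) = 1" and t: "t \<in> {0..T}"
      and eqn: "\<And>t y. 0 \<le> t \<Longrightarrow> time_deriv w t y + transport (w t) y + Theta V (w t) y
        = (K / 2) *\<^sub>R (complex_of_real (Re (w12 t y)) - Re (z t) *\<^sub>R w t y)" for w t
  proof -
    define I where "I = (\<lambda>t. phase_integral (w t))"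
    have iw: "integrable lborel (w t)" if "0 \<le> t" for t using adm that by (auto simp: admissible_def)
    have h: "((\<lambda>t. (K / 2) *\<^sub>R (complex_of_real (Re (z t)) - Re (z t) *\<^sub>R I t)) has_integral I t - I 0) {0..t}"
      if "0 \<le> t" for t
      using mass_balance[OF V adm that eqn] unfolding I_def
      by (rule has_integral_eq[rotated]) (use R iw in auto)
    have Ic: "continuous_on {0..T} I" by (rule integral_equation_continuous[OF h T])
    have "I t - 1 = 0"
    proof (rule linear_ode_zero[OF _ _ _ t])
      fix s assume s: "s \<in> {0..T}"
      have "(I has_vector_derivative (K / 2) *\<^sub>R (complex_of_real (Re (z s)) - Re (z s) *\<^sub>R I s)) (at s within {0..T})"
        by (rule integral_equation_derivative[OF h _ s]) (simp, intro continuous_intros zc Ic)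
      from has_vector_derivative_diff[OF this has_vector_derivative_const[of 1]]
      show "((\<lambda>t. I t - 1) has_vector_derivative complex_of_real (- (K / 2) * Re (z s)) * (I s - 1)) (at s within {0..T})"
        by (rule has_vector_derivative_eq_rhs) (simp add: scaleR_conv_of_real field_simps)
    next
      show "continuous_on {0..T} (\<lambda>s. complex_of_real (- (K / 2) * Re (z s)))" by (intro continuous_intros zc)
      show "I 0 - 1 = 0" using w0 by (simp add: I_def)
    qed
    then show ?thesis by (simp add: I_def)
  qed
  have hz': "((\<lambda>t. (K / 2) *\<^sub>R (1 - z t * z t)) has_integral z t - z 0) {0..t}" if "0 \<le> t" "t \<le> T" for t
    using hz[OF that(1)]
  proof (rule has_integral_eq[rotated])
    fix s assume "s \<in> {0..t}"
    then have s: "0 \<le> s" "s \<in> {0..T}" using that by auto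
    show "(LINT y|lborel. (K / 4) *\<^sub>R (w1 s y + w2 s y - 2 * z s * w12 s y)) = (K / 2) *\<^sub>R (1 - z s * z s)"
    proof -
      have "phase_integral (w1 s) = 1" by (rule mass1[OF adm(1) m(1) s(2) eq1])
      moreover have "phase_integral (w2 s) = 1" by (rule mass1[OF adm(2) m(2) s(2) eq2])
      ultimately show ?thesis
        unfolding R12[OF s(1)] by (simp add: scaleR_conv_of_real field_simps)
    qed
  qed
  have dz: "(z has_vector_derivative (K / 2) *\<^sub>R (1 - z t * z t)) (at t within {0..T})" if "t \<in> {0..T}" for t
    by (rule integral_equation_derivative[OF hz' _ that]) (assumption, assumption, intro continuous_intros zc)
  define u where "u = (\<lambda>t y. w1 t y - w2 t y)"
  define N where "N = (\<lambda>t. LINT y|lborel. (cmod (u t y))\<^sup>2)"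
  note dt = admissibleD(1)[OF adm(1)] admissibleD(1)[OF adm(2)]
  note dx = admissibleD(2)[OF adm(1)] admissibleD(2)[OF adm(2)]
  note cv = admissibleD(3)[OF adm(1)] admissibleD(3)[OF adm(2)]
  have equ: "time_deriv u t y + transport (u t) y + Theta V (u t) y = (- (K / 2) * Re (z t)) *\<^sub>R u t y"
    if t: "0 \<le> t" for t y
  proof -
    have "time_deriv u t y + transport (u t) y + Theta V (u t) y
      = (time_deriv w1 t y + transport (w1 t) y + Theta V (w1 t) y) - (time_deriv w2 t y + transport (w2 t) y + Theta V (w2 t) y)"
      unfolding u_def time_deriv_diff[OF dt[OF t] t] transport_diff[OF dx[OF t]] Theta_diff(2)[OF cv[OF t]]
      by simp
    also have "\<dots> = (- (K / 2) * Re (z t)) *\<^sub>R u t y"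
      unfolding eq1[OF t] eq2[OF t] u_def by (simp add: scaleR_conv_of_real field_simps)
    finally show ?thesis .
  qed
  have hN: "((\<lambda>t. - K * Re (z t) * N t) has_integral N t - N 0) {0..t}" if "0 \<le> t" for t
  proof -
    have "((\<lambda>t. 2 * (- (K / 2) * Re (z t)) * (LINT z|lborel. (cmod (u t z))\<^sup>2)) has_integral
     (LINT z|lborel. (cmod (u t z))\<^sup>2) - (LINT z|lborel. (cmod (u 0 z))\<^sup>2)) {0..t}"
    proof (rule energy_balance[OF _ that])
      show "energy_admissible V u" using en by (simp add: u_def)
      show "(\<lambda>s. u s y) differentiable (at t within {0..})" if "0 \<le> t" for t y
        unfolding u_def by (intro differentiable_diff dt that)
      show "(\<lambda>x'. u t (x', p)) differentiable (at x)" if "0 \<le> t" for t x p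
        unfolding u_def by (intro differentiable_diff dx that)
      show "integrable lborel (u t)" if "0 \<le> t" for t
        unfolding u_def using int that by auto
      show "Theta_converges V (u t)" if "0 \<le> t" for t
        unfolding u_def by (rule Theta_diff(1)[OF cv[OF that]])
      show "time_deriv u t y + transport (u t) y + Theta V (u t) y = (- (K / 2) * Re (z t)) *\<^sub>R u t y" if "0 \<le> t" for t y
        by (rule equ[OF that])
    qed
    then show ?thesis by (simp add: N_def)
  qed
  have Nc: "continuous_on {0..T} N" by (rule integral_equation_continuous[OF hN T])
  have dN: "(N has_vector_derivative - K * Re (z t) * N t) (at t within {0..T})" if "t \<in> {0..T}" for t
    by (rule integral_equation_derivative[OF hN _ that]) (simp, intro continuous_intros zc Nc)
  have L2: "(L2_norm_phase (\<lambda>y. w1 t y - w2 t y))\<^sup>2 = N t" for t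
    by (simp add: L2_norm_phase_def N_def u_def)
  have "N T * (cmod (1 + z 0))\<^sup>2 \<le> 4 * N 0 * exp (- K * T)"
    by (rule decay_of_order_parameter_system[OF T dz dN]) (use z0 in \<open>auto simp: z_def N_def\<close>)
  then show ?thesis unfolding L2 z_def .
qed

theorem theorem4p1:
  fixes K :: real
    and V :: "real ^ 'd::finite \<Rightarrow> real"
    and w1_0 w2_0 w12_0 :: "'d phase \<Rightarrow> complex"
  assumes "K \<ge> 0"
    and "V \<in> borel_measurable borel"
    and "\<And>z. w1_0 z \<in> \<real>" and "\<And>z. w2_0 z \<in> \<real>"
    and "phase_integral w1_0 = 1" and "phase_integral w2_0 = 1"
    and "cmod (phase_integral w12_0) \<le> 1" and "phase_integral w12_0 \<noteq> -1"
  shows "\<exists>C>0. \<forall>w1 w2 w12.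
           wigner_lohe_solution K V w1 w2 w12 \<and>
           w1 0 = w1_0 \<and> w2 0 = w2_0 \<and> w12 0 = w12_0 \<longrightarrow>
           (\<forall>\<^sub>F t in at_top.
              (L2_norm_phase (\<lambda>z. w1 t z - w2 t z))\<^sup>2 \<le> C * exp (- K * t))"
proof -
  define a where "a = (cmod (1 + phase_integral w12_0))\<^sup>2"
  define N0 where "N0 = (L2_norm_phase (\<lambda>z. w1_0 z - w2_0 z))\<^sup>2"
  have a: "a > 0" using assms(8) by (simp add: a_def) (metis add.commute add_eq_0_iff)
  have N0: "N0 \<ge> 0" by (simp add: N0_def)
  \<comment> \<open>adding 1 keeps the constant positive when the initial data coincide\<close>
  show ?thesis
  proof (intro exI[of _ "4 * N0 / a + 1"] conjI allI impI)
    show "0 < 4 * N0 / a + 1" using a N0 by (simp add: add_nonneg_pos)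
    fix w1 w2 w12
    assume "wigner_lohe_solution K V w1 w2 w12 \<and> w1 0 = w1_0 \<and> w2 0 = w2_0 \<and> w12 0 = w12_0"
    then have decay: "(L2_norm_phase (\<lambda>z. w1 t z - w2 t z))\<^sup>2 * a \<le> 4 * N0 * exp (- K * t)" if "0 \<le> t" for t
      using wigner_lohe_decay[OF assms(2), of K w1 w2 w12 t] assms that by (auto simp: a_def N0_def)
    show "\<forall>\<^sub>F t in at_top. (L2_norm_phase (\<lambda>z. w1 t z - w2 t z))\<^sup>2 \<le> (4 * N0 / a + 1) * exp (- K * t)"
      using eventually_ge_at_top[of 0]
    proof eventually_elim
      case (elim t)
      have "(L2_norm_phase (\<lambda>z. w1 t z - w2 t z))\<^sup>2 \<le> 4 * N0 / a * exp (- K * t)"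
        using decay[OF elim] a by (simp add: field_simps)
      also have "\<dots> \<le> (4 * N0 / a + 1) * exp (- K * t)" by (simp add: distrib_right)
      finally show ?case .
    qed
  qed
qed

end
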